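(* Let $\Omega=\mathbb{T}^d=\mathbb{R}^d/\mathbb{Z}^d$, let $\phi,\psi\in C^1(\Omega)$ and $g\in C^2(\Omega)$ with $\phi<\psi$ and $\phi\le g\le\psi$ in $\Omega$, and for $\varepsilon\in(0,1)$ let $u_\varepsilon$ be the classical solution of problem $(P_\varepsilon)$, with associated $H_\varepsilon,f_\varepsilon$ (see context). Assume that $$\sup_{\varepsilon\in(0,1)}\int_\Omega|-H_\varepsilon(x,0)+f_\varepsilon(x,0)|\,dx<\infty.$$ Then $$\sup_{\varepsilon\in(0,1),\,t\ge0}\int_\Omega|-H_\varepsilon(x,t)+f_\varepsilon(x,t)|\,dx<\infty.$$
   Context: Summation over repeated indices is used. For $p\in\mathbb{R}^d$, $|p|_\varepsilon=\sqrt{\varepsilon^2+|p|^2}$; $V_\varepsilon(s)=V_\varepsilon(x,s)=\frac1\varepsilon(\phi(x)-s)_+^4+\frac1\varepsilon(s-\psi(x))_+^4$, and $V_\varepsilon'$ is the derivative in $s$. Put $f_\varepsilon=-V_\varepsilon'(u_\varepsilon)$ and $H_\varepsilon=-\operatorname{div}\big(\nabla u_\varepsilon/|\nabla u_\varepsilon|_\varepsilon\big)$. Problem $(P_\varepsilon)$: $$\partial_t u_\varepsilon=\Big(\delta_{ij}-\frac{\partial_{x_i}u_\varepsilon\,\partial_{x_j}u_\varepsilon}{|\nabla u_\varepsilon|_\varepsilon^2}\Big)\partial_{x_ix_j}u_\varepsilon+|\nabla u_\varepsilon|_\varepsilon f_\varepsilon\ \text{ in }\Omega\times(0,\infty),\qquad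 u_\varepsilon(\cdot,0)=g,$$ equivalently $\partial_tu_\varepsilon=|\nabla u_\varepsilon|_\varepsilon(-H_\varepsilon+f_\varepsilon)$. *)

theory Defs
  imports "HOL-Analysis.Analysis"
begin

text \<open>
  Functions on the torus are represented by their \<open>\<int>\<^sup>d\<close>-periodic lifts to
  \<open>real ^ 'n\<close>, where \<open>d = CARD('n)\<close>; integrals over the torus are integrals over
  the unit cube \<open>cbox 0 1\<close>.
\<close>

definition Zd_periodic :: "(real ^ 'n \<Rightarrow> 'a) \<Rightarrow> bool" where
  "Zd_periodic f \<longleftrightarrow> (\<forall>x k. (\<forall>i. k $ i \<in> \<int>) \<longrightarrow> f (x + k) = f x)"

definition partial_deriv :: "'n \<Rightarrow> (real ^ 'n \<Rightarrow> real) \<Rightarrow> real ^ 'n \<Rightarrow> real" where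
  "partial_deriv i f x = deriv (\<lambda>s. f (x + s *\<^sub>R axis i 1)) 0"

primrec Ck :: "nat \<Rightarrow> (real ^ 'n \<Rightarrow> real) \<Rightarrow> bool" where
  "Ck 0 f \<longleftrightarrow> continuous_on UNIV f"
| "Ck (Suc k) f \<longleftrightarrow>
     continuous_on UNIV f \<and>
     (\<forall>i. (\<forall>x. (\<lambda>s. f (x + s *\<^sub>R axis i 1)) differentiable at 0) \<and> Ck k (partial_deriv i f))"

definition Ck_torus :: "nat \<Rightarrow> (real ^ 'n \<Rightarrow> real) \<Rightarrow> bool" where
  "Ck_torus k f \<longleftrightarrow> Zd_periodic f \<and> Ck k f"

definition grad :: "(real ^ 'n \<Rightarrow> real) \<Rightarrow> real ^ 'n \<Rightarrow> real ^ 'n" where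
  "grad f x = (\<chi> i. partial_deriv i f x)"

definition divergence :: "(real ^ 'n \<Rightarrow> real ^ 'n) \<Rightarrow> real ^ 'n \<Rightarrow> real" where
  "divergence F x = (\<Sum>i\<in>UNIV. partial_deriv i (\<lambda>y. F y $ i) x)"

definition reg_norm :: "real \<Rightarrow> real ^ 'n \<Rightarrow> real" where
  "reg_norm \<epsilon> p = sqrt (\<epsilon>\<^sup>2 + (norm p)\<^sup>2)"

definition penalty ::
  "(real ^ 'n \<Rightarrow> real) \<Rightarrow> (real ^ 'n \<Rightarrow> real) \<Rightarrow> real \<Rightarrow> real ^ 'n \<Rightarrow> real \<Rightarrow> real" where
  "penalty \<phi> \<psi> \<epsilon> x s = 1 / \<epsilon> * (max 0 (\<phi> x - s)) ^ 4 + 1 / \<epsilon> * (max 0 (s - \<psi> x)) ^ 4"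

text \<open>
  In the next two definitions \<open>v\<close> is a time slice \<open>u\<^sub>\<epsilon>(\<cdot>, t)\<close>.
\<close>

definition forcing ::
  "(real ^ 'n \<Rightarrow> real) \<Rightarrow> (real ^ 'n \<Rightarrow> real) \<Rightarrow> real \<Rightarrow> (real ^ 'n \<Rightarrow> real) \<Rightarrow> real ^ 'n \<Rightarrow> real" where
  "forcing \<phi> \<psi> \<epsilon> v x = - deriv (penalty \<phi> \<psi> \<epsilon> x) (v x)"

definition curvature :: "real \<Rightarrow> (real ^ 'n \<Rightarrow> real) \<Rightarrow> real ^ 'n \<Rightarrow> real" where
  "curvature \<epsilon> v x = - divergence (\<lambda>y. (1 / reg_norm \<epsilon> (grad v y)) *\<^sub>R grad v y) x"

text \<open>
  Classical regularity is \<open>C\<^sup>2\<^sup>,\<^sup>1\<close> up to the initial time, the natural class for initial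
  data in \<open>C\<^sup>2\<close> on the torus. Continuity of the time derivative is only
  demanded for \<open>t > 0\<close>; for solutions of the equation it extends to \<open>t = 0\<close>.
  Values of \<open>u x t\<close> for \<open>t < 0\<close> are irrelevant.
\<close>

definition C21_torus :: "(real ^ 'n \<Rightarrow> real \<Rightarrow> real) \<Rightarrow> bool" where
  "C21_torus u \<longleftrightarrow>
     (\<forall>t\<ge>0. Ck_torus 2 (\<lambda>x. u x t)) \<and>
     continuous_on (UNIV \<times> {0..}) (\<lambda>(x, t). u x t) \<and>
     (\<forall>i. continuous_on (UNIV \<times> {0..}) (\<lambda>(x, t). partial_deriv i (\<lambda>y. u y t) x)) \<and>
     (\<forall>i j. continuous_on (UNIV \<times> {0..})
        (\<lambda>(x, t). partial_deriv i (partial_deriv j (\<lambda>y. u y t)) x)) \<and>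
     (\<forall>x. \<forall>t>0. u x differentiable at t) \<and>
     continuous_on (UNIV \<times> {0<..}) (\<lambda>(x, t). deriv (u x) t)"

definition classical_solution ::
  "(real ^ 'n \<Rightarrow> real) \<Rightarrow> (real ^ 'n \<Rightarrow> real) \<Rightarrow> (real ^ 'n \<Rightarrow> real) \<Rightarrow> real \<Rightarrow>
   (real ^ 'n \<Rightarrow> real \<Rightarrow> real) \<Rightarrow> bool" where
  "classical_solution \<phi> \<psi> g \<epsilon> u \<longleftrightarrow>
     C21_torus u \<and>
     (\<forall>x. u x 0 = g x) \<and>
     (\<forall>x. \<forall>t>0.
        deriv (u x) t =
          (\<Sum>i\<in>UNIV. \<Sum>j\<in>UNIV.
             ((if i = j then 1 else 0)
               - partial_deriv i (\<lambda>y. u y t) x * partial_deriv j (\<lambda>y. u y t) x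
                 / (reg_norm \<epsilon> (grad (\<lambda>y. u y t) x))\<^sup>2)
             * partial_deriv i (partial_deriv j (\<lambda>y. u y t)) x)
          + reg_norm \<epsilon> (grad (\<lambda>y. u y t) x) * forcing \<phi> \<psi> \<epsilon> (\<lambda>y. u y t) x)"

end

theory Submission
  imports Defs
begin

text \<open>
  Write \<open>w = - H + f\<close> and \<open>N\<close> for the regularised gradient norm, so that \<open>u\<^sub>t = N w\<close>. Differentiating
  \<open>w = div (\<nabla>u / N) - V'(u)\<close> in time gives formally \<open>w\<^sub>t = div (A \<nabla>u\<^sub>t) - V''(u) u\<^sub>t\<close> with \<open>A\<close> positive
  and \<open>V'' \<ge> 0\<close>. Testing with \<open>sgn w = sgn u\<^sub>t\<close> shows that the \<open>L\<^sup>1\<close> norm of \<open>w\<close> is nonincreasing.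

  As \<open>u\<^sub>t\<close> is only continuous, the argument is run with time steps \<open>h\<close>. The difference
  \<open>w(t + h) - w(t)\<close> is tested with a smoothed sign \<open>\<zeta>\<close> of \<open>(u(t + h) - u(t)) / (h N)\<close>; monotonicity of
  \<open>p \<mapsto> p / |p|\<^sub>\<epsilon>\<close> and of \<open>V'\<close> yields a dissipation term in \<open>(\<nabla>u(t + h) - \<nabla>u(t)) / h\<close> and an error
  \<open>O(\<delta>)\<close>, where \<open>\<delta>\<close> is the smoothing parameter. The same difference divided by \<open>h\<close> is the time
  derivative of the mean of \<open>w\<close> over \<open>[t, t + h]\<close>. The smoothed sign of this mean differs from \<open>\<zeta>\<close> by
  at most a multiple of the increments of \<open>\<nabla>u\<close> on the step. Multiplied by the modulus of continuity
  of \<open>w\<close>, this error is absorbed by the dissipation. Then \<open>h\<close> and afterwards \<open>\<delta>\<close> tend to zero.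
\<close>

section \<open>The regularised norm and the flux\<close>

lemma reg_norm_pos: "0 < \<epsilon> \<Longrightarrow> 0 < reg_norm \<epsilon> p"
  by (simp add: reg_norm_def add_pos_nonneg)

lemma reg_norm_ge: "0 < \<epsilon> \<Longrightarrow> \<epsilon> \<le> reg_norm \<epsilon> p"
  unfolding reg_norm_def by (rule real_le_rsqrt) simp

lemma norm_le_reg_norm: "norm p \<le> reg_norm \<epsilon> p"
  unfolding reg_norm_def by (rule real_le_rsqrt) simp

lemma reg_norm_square: "(reg_norm \<epsilon> p)\<^sup>2 = \<epsilon>\<^sup>2 + (norm p)\<^sup>2"
  by (simp add: reg_norm_def)

text \<open>The regularised norm of p is the norm of the pair (\<epsilon>, p), so this is the
  reverse triangle inequality.\<close>

lemma reg_norm_lipschitz: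
  assumes "0 < \<epsilon>"
  shows "\<bar>reg_norm \<epsilon> p - reg_norm \<epsilon> q\<bar> \<le> norm (p - q)"
proof -
  have "reg_norm \<epsilon> p = norm (\<epsilon>, p)" for p :: "real ^ 'n"
    by (simp add: reg_norm_def norm_Pair)
  then have "\<bar>reg_norm \<epsilon> p - reg_norm \<epsilon> q\<bar> \<le> norm ((\<epsilon>, p) - (\<epsilon>, q))"
    by (metis norm_triangle_ineq3)
  then show ?thesis by (simp add: norm_Pair)
qed

lemma continuous_on_reg_norm [continuous_intros]:
  "continuous_on S f \<Longrightarrow> continuous_on S (\<lambda>x. reg_norm \<epsilon> (f x))"
  unfolding reg_norm_def by (intro continuous_intros)

text \<open>The gradient of the convex function \<open>reg_norm \<epsilon>\<close>. The curvature is
  minus the divergence of the flux of the spatial gradient.\<close>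

definition flux :: "real \<Rightarrow> real ^ 'n \<Rightarrow> real ^ 'n" where
  "flux \<epsilon> p = (1 / reg_norm \<epsilon> p) *\<^sub>R p"

lemma norm_flux_le: "0 < \<epsilon> \<Longrightarrow> norm (flux \<epsilon> p) \<le> 1"
  using reg_norm_pos[of \<epsilon> p] norm_le_reg_norm[of p \<epsilon>] by (simp add: flux_def field_simps)

lemma continuous_on_flux [continuous_intros]:
  "0 < \<epsilon> \<Longrightarrow> continuous_on S f \<Longrightarrow> continuous_on S (\<lambda>x. flux \<epsilon> (f x))"
  unfolding flux_def
  by (intro continuous_intros) (use reg_norm_pos in \<open>auto simp: less_le\<close>)

text \<open>The difference splits into a change of the vector over a fixed length and a change of
  the length along the second flux. Each part is at most |p - q| / \<epsilon>, since the flux has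
  norm at most 1 and the regularised norm is 1-Lipschitz.\<close>

lemma flux_lipschitz:
  assumes "0 < \<epsilon>"
  shows "norm (flux \<epsilon> p - flux \<epsilon> q) \<le> 2 / \<epsilon> * norm (p - q)"
proof -
  define N M where "N = reg_norm \<epsilon> p" and "M = reg_norm \<epsilon> q"
  have N: "0 < N" "\<epsilon> \<le> N" and M: "0 < M"
    using assms reg_norm_pos reg_norm_ge by (auto simp: N_def M_def)
  have eq: "flux \<epsilon> p - flux \<epsilon> q = (1 / N) *\<^sub>R (p - q) + ((M - N) / N) *\<^sub>R flux \<epsilon> q"
    using N M
    by (simp add: flux_def N_def[symmetric] M_def[symmetric] algebra_simps diff_divide_distrib)
  have "norm (flux \<epsilon> p - flux \<epsilon> q) \<le> norm (p - q) / N + \<bar>M - N\<bar> / N * norm (flux \<epsilon> q)"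
    unfolding eq using N by (intro norm_triangle_le) simp
  also have "\<dots> \<le> norm (p - q) / N + norm (p - q) / N * 1"
    using N reg_norm_lipschitz[OF assms, of q p] norm_flux_le[OF assms, of q]
    by (intro add_mono mult_mono divide_right_mono)
      (auto simp: N_def M_def norm_minus_commute)
  also have "\<dots> \<le> 2 / \<epsilon> * norm (p - q)"
    using N assms frac_le[of "2 * norm (p - q)" "2 * norm (p - q)" \<epsilon> N] by simp
  finally show ?thesis .
qed

text \<open>
  In terms of the augmented vectors \<open>P = (\<epsilon>, p)\<close> and \<open>Q = (\<epsilon>, q)\<close>, whose norms are the regularised norms,
  \<open>(P / |P| - Q / |Q|) \<bullet> (P - Q) = (|P| + |Q|) / 2 * |P / |P| - Q / |Q||\<^sup>2\<close>. The first components of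
  \<open>P\<close> and \<open>Q\<close> agree, so the directions determine \<open>P\<close> and \<open>Q\<close>, with a Lipschitz estimate.
\<close>

lemma flux_strongly_monotone:
  assumes "0 < \<epsilon>" "reg_norm \<epsilon> p \<le> R" "reg_norm \<epsilon> q \<le> R"
  shows "\<epsilon> / (2 * R\<^sup>2 * (1 + R\<^sup>2 / \<epsilon>\<^sup>2)) * (norm (p - q))\<^sup>2 \<le> (flux \<epsilon> p - flux \<epsilon> q) \<bullet> (p - q)"
proof -
  define N M where "N = reg_norm \<epsilon> p" and "M = reg_norm \<epsilon> q"
  have N: "0 < N" "\<epsilon> \<le> N" "N \<le> R" and M: "0 < M" "\<epsilon> \<le> M" "M \<le> R" and R: "0 < R"
    using assms reg_norm_pos[OF assms(1), of p] reg_norm_ge[OF assms(1), of p]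
      reg_norm_pos[OF assms(1), of q] reg_norm_ge[OF assms(1), of q]
    unfolding N_def M_def by linarith+
  have N2: "\<epsilon>\<^sup>2 + p \<bullet> p = N\<^sup>2" and M2: "\<epsilon>\<^sup>2 + q \<bullet> q = M\<^sup>2"
    by (simp_all add: N_def M_def reg_norm_square dot_square_norm)
  define a b where "a = flux \<epsilon> p" and "b = flux \<epsilon> q"
  have p: "p = N *\<^sub>R a" and q: "q = M *\<^sub>R b"
    using N M by (simp_all add: a_def b_def flux_def N_def M_def)
  \<comment> \<open>The squared distance between the normalised augmented vectors:
    \<open>a - b\<close> is its spatial part, \<open>\<epsilon> / N - \<epsilon> / M\<close> its
    first component.\<close>
  define D where "D = (norm (a - b))\<^sup>2 + (\<epsilon> / N - \<epsilon> / M)\<^sup>2"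
  have aa: "N\<^sup>2 * (a \<bullet> a) = N\<^sup>2 - \<epsilon>\<^sup>2" and bb: "M\<^sup>2 * (b \<bullet> b) = M\<^sup>2 - \<epsilon>\<^sup>2"
    using N2 M2 by (simp_all add: p q power2_eq_square algebra_simps)
  have aa': "a \<bullet> a = 1 - (\<epsilon>/N)\<^sup>2" and bb': "b \<bullet> b = 1 - (\<epsilon>/M)\<^sup>2"
    using aa bb N M by (simp_all add: field_simps)
  have "(a - b) \<bullet> (p - q) = N * (a \<bullet> a) + M * (b \<bullet> b) - (N + M) * (a \<bullet> b)"
    by (simp add: p q inner_commute algebra_simps)
  also have "\<dots> = (N + M) / 2 * D"
    unfolding D_def power2_norm_eq_inner using N M
    by (simp add: aa' bb' inner_commute inner_diff_left inner_diff_right)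
      (simp add: field_simps power2_eq_square)
  finally have 1: "(a - b) \<bullet> (p - q) = (N + M) / 2 * D" .
  have b1: "norm b \<le> 1" using norm_flux_le assms by (simp add: b_def)
  have "norm (p - q) = norm (N *\<^sub>R (a - b) + (N - M) *\<^sub>R b)"
    by (simp add: p q algebra_simps)
  also have "\<dots> \<le> N * norm (a - b) + \<bar>N - M\<bar> * norm b"
    using N by (intro norm_triangle_le) simp
  also have "\<dots> \<le> R * norm (a - b) + \<bar>N - M\<bar> * 1"
    using N b1 by (intro add_mono mult_mono mult_left_mono) auto
  \<comment> \<open>The first components of the normalised vectors determine the lengths
    \<open>N\<close> and \<open>M\<close>; this turns the length difference into the second
    ingredient of \<open>D\<close>.\<close>
  also have "\<bar>N - M\<bar> = (N * M / \<epsilon>) * \<bar>\<epsilon> / N - \<epsilon> / M\<bar>"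
  proof -
    have "N - M = - (N * M / \<epsilon>) * (\<epsilon> / N - \<epsilon> / M)"
      using N M assms by (simp add: field_simps)
    then have "\<bar>N - M\<bar> = \<bar>N * M / \<epsilon>\<bar> * \<bar>\<epsilon> / N - \<epsilon> / M\<bar>" by (metis abs_minus abs_mult mult_minus_left)
    then show ?thesis using N M assms by simp
  qed
  also have "(N * M / \<epsilon>) * \<bar>\<epsilon> / N - \<epsilon> / M\<bar> \<le> (R\<^sup>2 / \<epsilon>) * \<bar>\<epsilon> / N - \<epsilon> / M\<bar>"
    using N M assms by (intro mult_right_mono divide_right_mono)
      (auto simp: power2_eq_square intro!: mult_mono)
  finally have 2: "norm (p - q) \<le> R * norm (a - b) + (R\<^sup>2 / \<epsilon>) * \<bar>\<epsilon> / N - \<epsilon> / M\<bar>" by simp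
  have "(norm (p - q))\<^sup>2 \<le> (R * norm (a - b) + (R\<^sup>2 / \<epsilon>) * \<bar>\<epsilon> / N - \<epsilon> / M\<bar>)\<^sup>2"
    using 2 by (intro power_mono) auto
  also have "\<dots> \<le> 2 * (R * norm (a - b))\<^sup>2 + 2 * ((R\<^sup>2 / \<epsilon>) * \<bar>\<epsilon> / N - \<epsilon> / M\<bar>)\<^sup>2"
    using sum_squares_bound[of "R * norm (a - b)" "(R\<^sup>2 / \<epsilon>) * \<bar>\<epsilon> / N - \<epsilon> / M\<bar>"]
    by (simp add: power2_sum)
  also have "\<dots> = 2 * R\<^sup>2 * ((norm (a - b))\<^sup>2 + (R\<^sup>2 / \<epsilon>\<^sup>2) * (\<epsilon> / N - \<epsilon> / M)\<^sup>2)"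
  proof -
    have *: "2 * (R * n)\<^sup>2 + 2 * ((R\<^sup>2 / \<epsilon>) * \<bar>k\<bar>)\<^sup>2 = 2 * R\<^sup>2 * (n\<^sup>2 + (R\<^sup>2 / \<epsilon>\<^sup>2) * k\<^sup>2)" for n k
      using assms(1) by (simp add: power_mult_distrib power_divide field_simps power2_eq_square)
    show ?thesis by (rule *)
  qed
  also have "\<dots> \<le> 2 * R\<^sup>2 * ((1 + R\<^sup>2 / \<epsilon>\<^sup>2) * D)"
    unfolding D_def by (intro mult_left_mono) (auto simp: algebra_simps add_increasing)
  finally have 3: "(norm (p - q))\<^sup>2 \<le> (2 * R\<^sup>2 * (1 + R\<^sup>2 / \<epsilon>\<^sup>2)) * D" by (simp add: mult.assoc)
  have D0: "0 \<le> D" by (simp add: D_def)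
  have pos: "0 < 2 * R\<^sup>2 * (1 + R\<^sup>2 / \<epsilon>\<^sup>2)" using R by (simp add: add_pos_nonneg)
  have "\<epsilon> / (2 * R\<^sup>2 * (1 + R\<^sup>2 / \<epsilon>\<^sup>2)) * (norm (p - q))\<^sup>2
      \<le> \<epsilon> / (2 * R\<^sup>2 * (1 + R\<^sup>2 / \<epsilon>\<^sup>2)) * ((2 * R\<^sup>2 * (1 + R\<^sup>2 / \<epsilon>\<^sup>2)) * D)"
    using 3 pos assms by (intro mult_left_mono) auto
  also have "\<dots> = \<epsilon> * D"
  proof -
    have "\<epsilon> / K * (K * D) = \<epsilon> * D" if "0 < K" for K
      using that by simp
    then show ?thesis using pos by blast
  qed
  also have "\<dots> \<le> (N + M) / 2 * D" using D0 N M by (intro mult_right_mono) auto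
  finally show ?thesis unfolding 1[unfolded a_def b_def] .
qed

section \<open>Integration by parts on the torus\<close>

lemma content_unit_cube: "measure lborel (cbox 0 (1 :: real ^ 'n)) = 1"
  by (simp add: content_cbox_cart interval_ne_empty_cart)

lemma Zd_periodic_minus_axis:
  assumes "Zd_periodic f"
  shows "f (x - axis i 1) = f x"
proof -
  have "\<forall>j. (- axis i 1) $ j \<in> \<int>"
    by (simp add: axis_def)
  then have "f (x + - axis i 1) = f x"
    using assms unfolding Zd_periodic_def by blast
  then show ?thesis by simp
qed

text \<open>Cut the cube at height 1 - s in direction i. Translation carries the lower slab onto the
  part of the cube above height s; the upper slab leaves the cube, and periodicity brings it back
  onto the part below height s.\<close>

lemma integral_cube_axis_translate:
  fixes f :: "real ^ 'n \<Rightarrow> real"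
  assumes per: "Zd_periodic f" and cont: "continuous_on UNIV f" and s: "0 \<le> s" "s \<le> 1"
  shows "integral (cbox 0 1) (\<lambda>x. f (x + s *\<^sub>R axis i 1)) = integral (cbox 0 1) f"
proof -
  define e :: "real ^ 'n" where "e = axis i 1"
  have eB: "e \<in> Basis" by (simp add: e_def axis_in_Basis_iff)
  have ei: "x \<bullet> e = x $ i" for x by (simp add: e_def inner_axis)
  have int: "(\<lambda>x. f (x + c)) integrable_on cbox a b" for a b c
    by (intro integrable_continuous continuous_intros continuous_on_compose2[OF cont]) auto
  have shift: "integral (cbox (a + c) (b + c)) f = integral (cbox a b) (\<lambda>x. f (x + c))" for a b c
    using integral_shift_cbox_plus[of a b f c] by (simp add: o_def add.commute)
  \<comment> \<open>Corners of the slabs: \<open>m r\<close> is the upper corner of the part below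
    height \<open>r\<close>, \<open>l r\<close> the lower corner of the part above it.\<close>
  define m where "m r = (\<chi> j. if j = i then r else (1::real))" for r
  define l where "l r = (\<chi> j. if j = i then r else (0::real))" for r
  have box1: "cbox 0 1 \<inter> {x. x \<bullet> e \<le> r} = cbox 0 (m r)" if "0 \<le> r" "r \<le> 1" for r
    using interval_split_cart(1)[where a = 0 and b = 1 and k = i and c = r] that
    by (simp add: ei interval_cbox_cart m_def min_absorb2 cong: if_cong)
  have box2: "cbox 0 1 \<inter> {x. r \<le> x \<bullet> e} = cbox (l r) 1" if "0 \<le> r" "r \<le> 1" for r
    using interval_split_cart(2)[where a = 0 and b = 1 and k = i and c = r] that
    by (simp add: ei interval_cbox_cart l_def max_absorb2 cong: if_cong)
  have split: "integral (cbox 0 1) g = integral (cbox 0 (m r)) g + integral (cbox (l r) 1) g"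
    if "0 \<le> r" "r \<le> 1" "g integrable_on cbox 0 1" for r and g :: "real ^ 'n \<Rightarrow> real"
    using integral_split[OF that(3) eB, of r] that box1[of r] box2[of r]
    by (simp)
  have "integral (cbox 0 1) (\<lambda>x. f (x + s *\<^sub>R e))
      = integral (cbox 0 (m (1 - s))) (\<lambda>x. f (x + s *\<^sub>R e))
        + integral (cbox (l (1 - s)) 1) (\<lambda>x. f (x + s *\<^sub>R e))"
    using s int by (intro split) auto
  also have "integral (cbox 0 (m (1 - s))) (\<lambda>x. f (x + s *\<^sub>R e)) = integral (cbox (l s) 1) f"
  proof -
    have "0 + s *\<^sub>R e = l s" "m (1 - s) + s *\<^sub>R e = 1"
      by (auto simp: vec_eq_iff e_def l_def m_def axis_def)
    then show ?thesis using shift[of 0 "s *\<^sub>R e" "m (1 - s)"] by simp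
  qed
  also have "integral (cbox (l (1 - s)) 1) (\<lambda>x. f (x + s *\<^sub>R e)) = integral (cbox 0 (m s)) f"
  proof -
    \<comment> \<open>One full period is subtracted, so that the translated upper slab lands inside
      the cube.\<close>
    have "f (x + s *\<^sub>R e) = f (x + (s - 1) *\<^sub>R e)" for x
      using Zd_periodic_minus_axis[OF per, of "x + s *\<^sub>R e" i]
      by (simp add: e_def algebra_simps)
    moreover have "l (1 - s) + (s - 1) *\<^sub>R e = 0" "1 + (s - 1) *\<^sub>R e = m s"
      by (auto simp: vec_eq_iff e_def l_def m_def axis_def)
    ultimately show ?thesis using shift[of "l (1 - s)" "(s - 1) *\<^sub>R e" 1] by simp
  qed
  also have "integral (cbox (l s) 1) f + integral (cbox 0 (m s)) f = integral (cbox 0 1) f"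
    using split[of s f] s int[of 0] by simp
  finally show ?thesis by (simp add: e_def)
qed

text \<open>In contrast to \<open>partial_deriv\<close>, which is built on the total function
  \<open>deriv\<close>, this also asserts that the derivative exists.\<close>

abbreviation has_pderiv :: "(real ^ 'n \<Rightarrow> real) \<Rightarrow> real \<Rightarrow> 'n \<Rightarrow> real ^ 'n \<Rightarrow> bool" where
  "has_pderiv f d i x \<equiv> ((\<lambda>s. f (x + s *\<^sub>R axis i 1)) has_real_derivative d) (at 0)"

text \<open>The integral of the translate by s in direction i does not depend on s in [0, 1], while
  differentiation under the integral at s = 0 gives the integral of \<open>f'\<close>. Applied to a
  product, this is integration by parts without boundary terms.\<close>

lemma integral_cube_pderiv_eq_0:
  assumes per: "Zd_periodic f" and cont: "continuous_on UNIV f"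
    and d: "\<And>x. has_pderiv f (f' x) i x" and cont': "continuous_on UNIV f'"
  shows "integral (cbox 0 1) f' = 0"
proof -
  have d': "((\<lambda>s. f (x + s *\<^sub>R axis i 1)) has_real_derivative f' (x + s *\<^sub>R axis i 1))
      (at s within {0..1})" for x s
  proof -
    have "((\<lambda>h. f ((x + s *\<^sub>R axis i 1) + h *\<^sub>R axis i 1)) has_real_derivative
        f' (x + s *\<^sub>R axis i 1)) (at (s - s))"
      using d[of "x + s *\<^sub>R axis i 1"] by simp
    then have "((\<lambda>r. f ((x + s *\<^sub>R axis i 1) + (r - s) *\<^sub>R axis i 1)) has_real_derivative
        f' (x + s *\<^sub>R axis i 1) * 1) (at s)"
      by (rule DERIV_chain2[where g = "\<lambda>r. r - s"]) (auto intro!: derivative_eq_intros)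
    then show ?thesis by (simp add: algebra_simps has_field_derivative_at_within)
  qed
  have D1: "((\<lambda>s. integral (cbox 0 1) (\<lambda>x. f (x + s *\<^sub>R axis i 1))) has_real_derivative
      integral (cbox 0 1) (\<lambda>x. f' (x + 0 *\<^sub>R axis i 1))) (at 0 within {0..1})"
  proof (rule leibniz_rule_field_derivative)
    show "(\<lambda>x. f (x + s *\<^sub>R axis i 1)) integrable_on cbox 0 1" for s
      by (intro integrable_continuous continuous_intros continuous_on_compose2[OF cont]) auto
    show "continuous_on ({0..1} \<times> cbox 0 1) (\<lambda>(s, x). f' (x + s *\<^sub>R axis i 1))"
      unfolding split_beta
      by (intro continuous_intros continuous_on_compose2[OF cont']) auto
  qed (use d' in auto)
  have D2: "((\<lambda>s. integral (cbox 0 1) (\<lambda>x. f (x + s *\<^sub>R axis i 1))) has_real_derivative 0)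
      (at 0 within {0..1})"
    by (rule has_field_derivative_transform_within[OF DERIV_const[of "integral (cbox 0 1) f"], of 1])
      (use integral_cube_axis_translate[OF per cont] in auto)
  \<comment> \<open>The translation lemma covers s in [0, 1] only, so both derivatives are
    one-sided; they agree because 0 is a limit point of the interval.\<close>
  have ne: "at (0::real) within {0..1} \<noteq> bot"
    by (simp add: trivial_limit_within)
  have "integral (cbox 0 1) (\<lambda>x. f' (x + 0 *\<^sub>R axis i 1)) = 0"
    by (rule vector_derivative_unique_within[OF ne D1[unfolded has_real_derivative_iff_has_vector_derivative]
        D2[unfolded has_real_derivative_iff_has_vector_derivative]])
  then show ?thesis by simp
qed

section \<open>Calculus for a time slice\<close>

lemma has_pderiv_imp_partial_deriv: "has_pderiv f d i x \<Longrightarrow> partial_deriv i f x = d"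
  unfolding partial_deriv_def by (rule DERIV_imp_deriv)

lemma Ck_Suc_has_pderiv: "Ck (Suc k) f \<Longrightarrow> has_pderiv f (partial_deriv i f x) i x"
  unfolding partial_deriv_def Ck.simps using DERIV_deriv_iff_real_differentiable by blast

lemma Zd_periodic_partial_deriv:
  assumes "Zd_periodic f"
  shows "Zd_periodic (partial_deriv i f)"
  unfolding Zd_periodic_def partial_deriv_def
proof (intro allI impI)
  fix x k :: "real ^ 'a"
  assume "\<forall>i. k $ i \<in> \<int>"
  then have "f (x + s *\<^sub>R axis i 1 + k) = f (x + s *\<^sub>R axis i 1)" for s
    using assms unfolding Zd_periodic_def by blast
  then show "deriv (\<lambda>s. f (x + k + s *\<^sub>R axis i 1)) 0 = deriv (\<lambda>s. f (x + s *\<^sub>R axis i 1)) 0"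
    by (simp add: add_ac)
qed

lemma Ck2D:
  assumes "Ck 2 v"
  shows "continuous_on UNIV v" "continuous_on UNIV (grad v)"
    "continuous_on UNIV (partial_deriv i (partial_deriv j v))"
    "has_pderiv v (grad v x $ i) i x"
    "has_pderiv (\<lambda>y. grad v y $ j) (partial_deriv i (partial_deriv j v) x) i x"
proof -
  have 2: "Ck (Suc (Suc 0)) v" using assms by (simp add: numeral_2_eq_2)
  then have 1: "Ck (Suc 0) (partial_deriv j v)" for j by simp
  show "continuous_on UNIV v" "continuous_on UNIV (partial_deriv i (partial_deriv j v))"
    using 2 by simp_all
  show "continuous_on UNIV (grad v)"
    unfolding grad_def using 1 by (intro continuous_intros) simp
  show "has_pderiv v (grad v x $ i) i x"
    using Ck_Suc_has_pderiv[OF 2] by (simp add: grad_def)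
  show "has_pderiv (\<lambda>y. grad v y $ j) (partial_deriv i (partial_deriv j v) x) i x"
    using Ck_Suc_has_pderiv[OF 1] by (simp add: grad_def)
qed

lemma Zd_periodic_grad: "Zd_periodic v \<Longrightarrow> Zd_periodic (grad v)"
  using Zd_periodic_partial_deriv[of v] by (simp add: Zd_periodic_def grad_def)

lemma reg_norm_components: "reg_norm \<epsilon> p = sqrt (\<epsilon>\<^sup>2 + (\<Sum>j\<in>UNIV. (p $ j)\<^sup>2))"
  by (simp add: reg_norm_def norm_vec_def L2_set_def sum_nonneg)

section \<open>Spatial derivatives of the regularised norm and of the flux\<close>

lemma has_pderiv_reg_norm:
  assumes "0 < \<epsilon>" "\<And>j. has_pderiv (\<lambda>y. G y $ j) (H j) i x"
  shows "has_pderiv (\<lambda>y. reg_norm \<epsilon> (G y)) ((\<Sum>j\<in>UNIV. G x $ j * H j) / reg_norm \<epsilon> (G x)) i x"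
proof -
  have pos: "0 < \<epsilon>\<^sup>2 + (\<Sum>j\<in>UNIV. (G x $ j)\<^sup>2)"
    using assms(1) by (simp add: add_pos_nonneg sum_nonneg)
  have "has_pderiv (\<lambda>y. \<epsilon>\<^sup>2 + (\<Sum>j\<in>UNIV. (G y $ j)\<^sup>2)) (\<Sum>j\<in>UNIV. 2 * (G x $ j * H j)) i x"
    by (rule derivative_eq_intros assms refl)+ (simp add: mult_ac)
  from this have "has_pderiv (\<lambda>y. sqrt (\<epsilon>\<^sup>2 + (\<Sum>j\<in>UNIV. (G y $ j)\<^sup>2)))
      (inverse (sqrt (\<epsilon>\<^sup>2 + (\<Sum>j\<in>UNIV. (G x $ j)\<^sup>2))) / 2 * (\<Sum>j\<in>UNIV. 2 * (G x $ j * H j))) i x"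
    by (rule DERIV_chain2[rotated]) (use DERIV_real_sqrt[OF pos] in simp)
  moreover have "inverse a / 2 * (\<Sum>j\<in>UNIV. 2 * (G x $ j * H j)) = (\<Sum>j\<in>UNIV. G x $ j * H j) / a" for a
    unfolding sum_distrib_left[symmetric] by (simp add: field_simps)
  ultimately show ?thesis
    unfolding reg_norm_components by simp
qed

text \<open>Component i of the differential of the flux at p, applied to the direction H. As a
  matrix this differential is (I - p p^T / |p|^2) / |p|, with the regularised norm
  throughout.\<close>

definition flux_deriv :: "real \<Rightarrow> real ^ 'n \<Rightarrow> ('n \<Rightarrow> real) \<Rightarrow> 'n \<Rightarrow> real" where
  "flux_deriv \<epsilon> p H i = H i / reg_norm \<epsilon> p - p $ i * (\<Sum>j\<in>UNIV. p $ j * H j) / reg_norm \<epsilon> p ^ 3"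

lemma has_pderiv_flux:
  assumes "0 < \<epsilon>" "\<And>j. has_pderiv (\<lambda>y. G y $ j) (H j) i x"
  shows "has_pderiv (\<lambda>y. flux \<epsilon> (G y) $ i) (flux_deriv \<epsilon> (G x) H i) i x"
proof -
  have N: "0 < reg_norm \<epsilon> (G x)" using reg_norm_pos assms(1) .
  have "has_pderiv (\<lambda>y. G y $ i / reg_norm \<epsilon> (G y))
      ((H i * reg_norm \<epsilon> (G x) - G x $ i * ((\<Sum>j\<in>UNIV. G x $ j * H j) / reg_norm \<epsilon> (G x)))
        / (reg_norm \<epsilon> (G x) * reg_norm \<epsilon> (G x))) i x"
    using DERIV_divide[OF assms(2)[of i] has_pderiv_reg_norm[OF assms]] N by simp
  moreover have "(H i * reg_norm \<epsilon> (G x) - G x $ i * ((\<Sum>j\<in>UNIV. G x $ j * H j) / reg_norm \<epsilon> (G x)))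
        / (reg_norm \<epsilon> (G x) * reg_norm \<epsilon> (G x)) = flux_deriv \<epsilon> (G x) H i"
    using N by (simp add: flux_deriv_def field_simps power2_eq_square power3_eq_cube)
  ultimately show ?thesis
    by (simp add: flux_def)
qed

text \<open>The argument order makes \<open>hess_row v x i\<close> the derivative of the gradient in
  direction i, the form in which \<open>flux_deriv\<close> takes its direction.\<close>

definition hess_row :: "(real ^ 'n \<Rightarrow> real) \<Rightarrow> real ^ 'n \<Rightarrow> 'n \<Rightarrow> 'n \<Rightarrow> real" where
  "hess_row v x i j = partial_deriv i (partial_deriv j v) x"

lemma curvature_eq:
  assumes "0 < \<epsilon>" "Ck 2 v"
  shows "curvature \<epsilon> v x = - (\<Sum>i\<in>UNIV. flux_deriv \<epsilon> (grad v x) (hess_row v x i) i)"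
proof -
  have "has_pderiv (\<lambda>y. flux \<epsilon> (grad v y) $ i) (flux_deriv \<epsilon> (grad v x) (hess_row v x i) i) i x" for i
    unfolding hess_row_def[abs_def] by (rule has_pderiv_flux[OF assms(1) Ck2D(5)[OF assms(2)]])
  then have "partial_deriv i (\<lambda>y. flux \<epsilon> (grad v y) $ i) x = flux_deriv \<epsilon> (grad v x) (hess_row v x i) i" for i
    by (rule has_pderiv_imp_partial_deriv)
  then show ?thesis
    unfolding curvature_def divergence_def flux_def[symmetric] by simp
qed

section \<open>The obstacle force and the speed\<close>

definition obstacle_force :: "(real ^ 'n \<Rightarrow> real) \<Rightarrow> (real ^ 'n \<Rightarrow> real) \<Rightarrow> real \<Rightarrow> real ^ 'n \<Rightarrow> real \<Rightarrow> real" where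
  "obstacle_force \<phi> \<psi> \<epsilon> x s = 4 / \<epsilon> * ((max 0 (\<phi> x - s)) ^ 3 - (max 0 (s - \<psi> x)) ^ 3)"

lemma DERIV_max_0_power4: "((\<lambda>s::real. (max 0 s) ^ 4) has_real_derivative 4 * (max 0 s) ^ 3) (at s)"
proof (cases s "0::real" rule: linorder_cases)
  case less
  have "((\<lambda>s::real. 0) has_real_derivative 0) (at s)" by simp
  then have "((\<lambda>s::real. (max 0 s) ^ 4) has_real_derivative 0) (at s)"
    by (rule has_field_derivative_transform_within_open[of _ _ _ "{..<0}"]) (use less in auto)
  then show ?thesis using less by simp
next
  case greater
  have "((\<lambda>s::real. s ^ 4) has_real_derivative 4 * s ^ 3) (at s)"
    by (rule derivative_eq_intros refl | simp)+
  then have "((\<lambda>s::real. (max 0 s) ^ 4) has_real_derivative 4 * s ^ 3) (at s)"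
    by (rule has_field_derivative_transform_within_open[of _ _ _ "{0<..}"]) (use greater in auto)
  then show ?thesis using greater by simp
next
  case equal
  \<comment> \<open>At the kink the difference quotient is bounded by |h|^3.\<close>
  have "((\<lambda>h::real. (max 0 h) ^ 4 / h) \<longlongrightarrow> 0) (at 0)"
  proof (rule Lim_null_comparison)
    have "norm ((max 0 h) ^ 4 / h) \<le> \<bar>h\<bar> ^ 3" for h :: real
    proof (cases "0 < h")
      case True
      then show ?thesis by (simp add: eval_nat_numeral)
    next
      case False
      then have "max 0 h = 0" by simp
      then show ?thesis by simp
    qed
    then show "\<forall>\<^sub>F h in at 0. norm ((max 0 h) ^ 4 / h) \<le> \<bar>h::real\<bar> ^ 3" by simp
    show "((\<lambda>h::real. \<bar>h\<bar> ^ 3) \<longlongrightarrow> 0) (at 0)"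
      by (auto intro!: tendsto_eq_intros)
  qed
  then show ?thesis using equal by (simp add: DERIV_def)
qed

text \<open>In place of \<open>deriv\<close> this gives a closed formula, from which continuity and
  monotonicity in the height can be read off.\<close>

lemma forcing_eq: "forcing \<phi> \<psi> \<epsilon> v x = obstacle_force \<phi> \<psi> \<epsilon> x (v x)"
proof -
  have 1: "((\<lambda>s. (max 0 (\<phi> x - s)) ^ 4) has_real_derivative 4 * (max 0 (\<phi> x - v x)) ^ 3 * (- 1)) (at (v x))"
    by (rule DERIV_chain2[OF DERIV_max_0_power4]) (auto intro!: derivative_eq_intros)
  have 2: "((\<lambda>s. (max 0 (s - \<psi> x)) ^ 4) has_real_derivative 4 * (max 0 (v x - \<psi> x)) ^ 3 * 1) (at (v x))"
    by (rule DERIV_chain2[OF DERIV_max_0_power4]) (auto intro!: derivative_eq_intros)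
  have "(penalty \<phi> \<psi> \<epsilon> x has_real_derivative
      1 / \<epsilon> * (4 * (max 0 (\<phi> x - v x)) ^ 3 * (- 1)) + 1 / \<epsilon> * (4 * (max 0 (v x - \<psi> x)) ^ 3 * 1)) (at (v x))"
    unfolding penalty_def[abs_def] by (intro DERIV_add DERIV_cmult 1 2)
  then show ?thesis
    unfolding forcing_def by (subst DERIV_imp_deriv) (auto simp: obstacle_force_def algebra_simps)
qed

text \<open>This is the convexity of the penalty in the height. It gives the zero-order term a
  favourable sign when the difference of two speeds is tested.\<close>

lemma obstacle_force_antimono:
  assumes "0 < \<epsilon>" "s \<le> t"
  shows "obstacle_force \<phi> \<psi> \<epsilon> x t \<le> obstacle_force \<phi> \<psi> \<epsilon> x s"
  unfolding obstacle_force_def using assms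
  by (intro mult_left_mono diff_mono power_mono) auto

lemma continuous_on_obstacle_force [continuous_intros]:
  "continuous_on UNIV \<phi> \<Longrightarrow> continuous_on UNIV \<psi> \<Longrightarrow> continuous_on S f \<Longrightarrow> continuous_on S g
   \<Longrightarrow> continuous_on S (\<lambda>y. obstacle_force \<phi> \<psi> \<epsilon> (f y) (g y))"
  unfolding obstacle_force_def
  by (intro continuous_intros continuous_on_compose2[of UNIV \<phi> S] continuous_on_compose2[of UNIV \<psi> S]) auto

text \<open>The quantity whose L^1 norm is to be bounded. Along a solution it is the time derivative
  of u divided by the regularised gradient norm.\<close>

definition speed :: "(real ^ 'n \<Rightarrow> real) \<Rightarrow> (real ^ 'n \<Rightarrow> real) \<Rightarrow> real \<Rightarrow> (real ^ 'n \<Rightarrow> real) \<Rightarrow> real ^ 'n \<Rightarrow> real" where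
  "speed \<phi> \<psi> \<epsilon> v x = - curvature \<epsilon> v x + forcing \<phi> \<psi> \<epsilon> v x"

lemma speed_eq:
  assumes "0 < \<epsilon>" "Ck 2 v"
  shows "speed \<phi> \<psi> \<epsilon> v x = (\<Sum>i\<in>UNIV. flux_deriv \<epsilon> (grad v x) (hess_row v x i) i)
    + obstacle_force \<phi> \<psi> \<epsilon> x (v x)"
  by (simp add: speed_def curvature_eq[OF assms] forcing_eq)

text \<open>The equivalence of the nondivergence and the geometric form of the equation. It holds
  row by row: the inner sum over j is N times the derivative of flux component i in direction
  i.\<close>

lemma reg_norm_mult_speed:
  assumes "0 < \<epsilon>" "Ck 2 v"
  shows "(\<Sum>i\<in>UNIV. \<Sum>j\<in>UNIV.
             ((if i = j then 1 else 0)
               - partial_deriv i v x * partial_deriv j v x / (reg_norm \<epsilon> (grad v x))\<^sup>2)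
             * partial_deriv i (partial_deriv j v) x)
          + reg_norm \<epsilon> (grad v x) * forcing \<phi> \<psi> \<epsilon> v x
    = reg_norm \<epsilon> (grad v x) * speed \<phi> \<psi> \<epsilon> v x"
proof -
  define N where "N = reg_norm \<epsilon> (grad v x)"
  have N: "0 < N" using reg_norm_pos[OF assms(1)] by (simp add: N_def)
  have "(\<Sum>j\<in>UNIV. ((if i = j then 1 else 0) - partial_deriv i v x * partial_deriv j v x / N\<^sup>2)
             * partial_deriv i (partial_deriv j v) x)
     = N * flux_deriv \<epsilon> (grad v x) (hess_row v x i) i" for i
  proof -
    have "(\<Sum>j\<in>UNIV. ((if i = j then 1 else 0) - a i * a j / N\<^sup>2) * b j)
        = b i - a i / N\<^sup>2 * (\<Sum>j\<in>UNIV. a j * b j)" for a b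
    proof -
      have "((if i = j then 1 else 0) - a i * a j / N\<^sup>2) * b j
          = (if i = j then b j else 0) - a i / N\<^sup>2 * (a j * b j)" for j
        by (simp add: left_diff_distrib)
      then show ?thesis
        by (simp add: sum_subtractf sum_distrib_left)
    qed
    then have "(\<Sum>j\<in>UNIV. ((if i = j then 1 else 0) - partial_deriv i v x * partial_deriv j v x / N\<^sup>2)
             * partial_deriv i (partial_deriv j v) x)
      = partial_deriv i (partial_deriv i v) x
        - partial_deriv i v x / N\<^sup>2 * (\<Sum>j\<in>UNIV. partial_deriv j v x * partial_deriv i (partial_deriv j v) x)" .
    also have "\<dots> = N * flux_deriv \<epsilon> (grad v x) (hess_row v x i) i"
    proof -
      have "a - b / N\<^sup>2 * S = N * (a / N - b * S / N ^ 3)" for a b S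
        using N by (simp add: field_simps power2_eq_square power3_eq_cube)
      then show ?thesis
        by (simp add: flux_deriv_def hess_row_def N_def[symmetric]) (simp add: grad_def)
    qed
    finally show ?thesis .
  qed
  then show ?thesis
    unfolding N_def[symmetric] speed_eq[OF assms] forcing_eq
    by (simp add: sum_distrib_left distrib_left)
qed

section \<open>The tested inequality for two time slices\<close>

text \<open>The pointwise algebra behind \<open>slice_inequality\<close>. There N is the regularised
  gradient norm, q the root in the test function, D the scaled gradient increment, X the pairing of
  the flux increment with the gradient increment and Y its pairing with the gradient of N. Half of
  the dissipation N X absorbs r Y; what remains of r Y is of order \<delta>.\<close>

lemma absorption_inequality:
  fixes \<epsilon> \<delta> c L Q N D r q X Y :: real
  assumes pos: "0 < \<epsilon>" "0 < \<delta>" "0 < c" "\<epsilon> \<le> N" and q: "\<delta> * N \<le> q" "r\<^sup>2 \<le> q\<^sup>2" "q \<le> Q"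
    and X: "c * D\<^sup>2 \<le> X" and Y: "\<bar>Y\<bar> \<le> 2 / \<epsilon> * D * L"
  shows "\<delta>\<^sup>2 * \<epsilon>\<^sup>2 * c / (2 * Q ^ 3) * D\<^sup>2 - \<delta> * (2 * L\<^sup>2 / (c * \<epsilon> ^ 3))
    \<le> \<delta>\<^sup>2 * N / q ^ 3 * (N * X - r * Y)"
proof -
  have N: "0 < N" using pos by linarith
  have "\<delta> * \<epsilon> \<le> \<delta> * N" using pos by simp
  then have q0: "\<delta> * \<epsilon> \<le> q" "0 < q" using q pos mult_pos_pos[of \<delta> \<epsilon>] by linarith+
  define Z where "Z = 2 / \<epsilon> * L"
  have "r * Y \<le> \<bar>r\<bar> * (2 / \<epsilon> * D * L)"
    using Y by (metis abs_ge_self abs_ge_zero abs_mult mult_left_mono order_trans)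
  also have "\<dots> = \<bar>r\<bar> * Z * D" by (simp add: Z_def)
  also have "\<dots> \<le> N * c / 2 * D\<^sup>2 + Z\<^sup>2 / (2 * N * c) * r\<^sup>2"
  proof -
    \<comment> \<open>Young's inequality, with weights chosen so that the quadratic term in
      \<open>D\<close> is half of \<open>N * c * D\<^sup>2\<close>.\<close>
    have "0 \<le> (N * c * D - \<bar>r\<bar> * Z)\<^sup>2 / (2 * N * c)" using N pos by simp
    also have "\<dots> = N * c / 2 * D\<^sup>2 + Z\<^sup>2 / (2 * N * c) * r\<^sup>2 - \<bar>r\<bar> * Z * D"
    proof -
      have "(N * c * D - \<bar>r\<bar> * Z)\<^sup>2 = (N * c)\<^sup>2 * D\<^sup>2 + r\<^sup>2 * Z\<^sup>2 - 2 * (N * c) * (\<bar>r\<bar> * Z * D)"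
        by (simp add: power2_diff power_mult_distrib)
      then show ?thesis using N pos by (simp add: field_simps power2_eq_square)
    qed
    finally show ?thesis by simp
  qed
  finally have "r * Y \<le> N * c / 2 * D\<^sup>2 + Z\<^sup>2 / (2 * N * c) * r\<^sup>2" .
  moreover have "N * (c * D\<^sup>2) \<le> N * X" using X N by simp
  ultimately have "N * c / 2 * D\<^sup>2 - Z\<^sup>2 / (2 * N * c) * r\<^sup>2 \<le> N * X - r * Y" by simp
  then have "\<delta>\<^sup>2 * N / q ^ 3 * (N * c / 2 * D\<^sup>2 - Z\<^sup>2 / (2 * N * c) * r\<^sup>2)
      \<le> \<delta>\<^sup>2 * N / q ^ 3 * (N * X - r * Y)"
    using N q0 by (intro mult_left_mono) auto
  moreover have "\<delta>\<^sup>2 * N / q ^ 3 * (N * c / 2 * D\<^sup>2 - Z\<^sup>2 / (2 * N * c) * r\<^sup>2)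
      = \<delta>\<^sup>2 * c * D\<^sup>2 * N\<^sup>2 / (2 * q ^ 3) - \<delta>\<^sup>2 * Z\<^sup>2 / (2 * c) * (r\<^sup>2 / q ^ 3)"
    using N q0 pos by (simp add: field_simps power2_eq_square)
  moreover have "\<delta>\<^sup>2 * \<epsilon>\<^sup>2 * c / (2 * Q ^ 3) * D\<^sup>2 \<le> \<delta>\<^sup>2 * c * D\<^sup>2 * N\<^sup>2 / (2 * q ^ 3)"
  proof -
    have "\<delta>\<^sup>2 * c * D\<^sup>2 * \<epsilon>\<^sup>2 / (2 * Q ^ 3) \<le> \<delta>\<^sup>2 * c * D\<^sup>2 * N\<^sup>2 / (2 * q ^ 3)"
      using q0 q pos by (intro frac_le mult_left_mono power_mono) auto
    then show ?thesis by (simp add: mult_ac)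
  qed
  moreover have "\<delta>\<^sup>2 * Z\<^sup>2 / (2 * c) * (r\<^sup>2 / q ^ 3) \<le> \<delta> * (2 * L\<^sup>2 / (c * \<epsilon> ^ 3))"
  proof -
    \<comment> \<open>Only one power of 1/q survives, and q is at least \<delta> \<epsilon>; with
      the prefactor \<open>\<delta>\<^sup>2\<close> this leaves one factor \<delta>.\<close>
    have "r\<^sup>2 / q ^ 3 \<le> q\<^sup>2 / q ^ 3" using q q0 by (intro divide_right_mono) auto
    also have "\<dots> = 1 / q" using q0 by (simp add: power2_eq_square power3_eq_cube)
    also have "\<dots> \<le> 1 / (\<delta> * \<epsilon>)" using q0 pos by (intro divide_left_mono) auto
    finally have "\<delta>\<^sup>2 * Z\<^sup>2 / (2 * c) * (r\<^sup>2 / q ^ 3) \<le> \<delta>\<^sup>2 * Z\<^sup>2 / (2 * c) * (1 / (\<delta> * \<epsilon>))"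
      using pos by (intro mult_left_mono) auto
    also have "\<dots> = \<delta> * (2 * L\<^sup>2 / (c * \<epsilon> ^ 3))"
      using pos by (simp add: Z_def field_simps power2_eq_square power3_eq_cube)
    finally show ?thesis .
  qed
  ultimately show ?thesis by linarith
qed

text \<open>The strong monotonicity constant of \<open>flux_strongly_monotone\<close> for vectors of
  regularised norm at most R.\<close>

definition mono_const :: "real \<Rightarrow> real \<Rightarrow> real" where
  "mono_const \<epsilon> R = \<epsilon> / (2 * R\<^sup>2 * (1 + R\<^sup>2 / \<epsilon>\<^sup>2))"

text \<open>
  With \<open>r\<close> the difference quotient of \<open>u\<close> in time and \<open>N\<close> the regularised gradient norm, \<open>r / N\<close> approximates the
  speed, and \<open>test_fun \<delta> N r\<close> is the smoothed sign of \<open>r / N\<close>. Unlike the speed itself, \<open>r\<close> and \<open>N\<close> are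
  differentiable in space.
\<close>

definition test_fun :: "real \<Rightarrow> real \<Rightarrow> real \<Rightarrow> real" where
  "test_fun \<delta> N r = r / sqrt (\<delta>\<^sup>2 * N\<^sup>2 + r\<^sup>2)"

text \<open>The test function is homogeneous of degree zero in (N, r). Hence only N r' - r N', the
  numerator of the derivative of r / N, enters, and its coefficient is positive.\<close>

lemma DERIV_test_fun:
  assumes "0 < \<delta>" "0 < N s" "(N has_real_derivative N') (at s)" "(r has_real_derivative r') (at s)"
  shows "((\<lambda>s. test_fun \<delta> (N s) (r s)) has_real_derivative
    \<delta>\<^sup>2 * N s / sqrt (\<delta>\<^sup>2 * (N s)\<^sup>2 + (r s)\<^sup>2) ^ 3 * (N s * r' - r s * N')) (at s)"
proof -
  define q where "q = sqrt (\<delta>\<^sup>2 * (N s)\<^sup>2 + (r s)\<^sup>2)"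
  have pos: "0 < \<delta>\<^sup>2 * (N s)\<^sup>2 + (r s)\<^sup>2" using assms by (simp add: add_pos_nonneg)
  have q: "0 < q" "q\<^sup>2 = \<delta>\<^sup>2 * (N s)\<^sup>2 + (r s)\<^sup>2"
    using pos by (simp_all add: q_def)
  have "((\<lambda>s. \<delta>\<^sup>2 * (N s)\<^sup>2 + (r s)\<^sup>2) has_real_derivative
      2 * (\<delta>\<^sup>2 * N s * N' + r s * r')) (at s)"
    by (rule derivative_eq_intros assms(3,4) refl)+ simp
  from DERIV_chain2[OF DERIV_real_sqrt[OF pos] this]
  have "((\<lambda>s. sqrt (\<delta>\<^sup>2 * (N s)\<^sup>2 + (r s)\<^sup>2)) has_real_derivative
      (\<delta>\<^sup>2 * N s * N' + r s * r') / q) (at s)"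
    unfolding q_def[symmetric] by (rule DERIV_cong) (use q(1) in \<open>simp add: field_simps\<close>)
  from DERIV_divide[OF assms(4) this]
  have "((\<lambda>s. test_fun \<delta> (N s) (r s)) has_real_derivative
      (r' * q - r s * ((\<delta>\<^sup>2 * N s * N' + r s * r') / q)) / (q * q)) (at s)"
    using q by (simp add: test_fun_def q_def[symmetric])
  moreover have "(r' * q - r s * ((\<delta>\<^sup>2 * N s * N' + r s * r') / q)) / (q * q)
      = (r' * q\<^sup>2 - r s * (\<delta>\<^sup>2 * N s * N' + r s * r')) / q ^ 3"
    using q(1) by (simp add: field_simps power2_eq_square power3_eq_cube)
  moreover have "r' * q\<^sup>2 - r s * (\<delta>\<^sup>2 * N s * N' + r s * r') = \<delta>\<^sup>2 * N s * (N s * r' - r s * N')"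
    unfolding q(2) by (simp add: algebra_simps power2_eq_square)
  ultimately show ?thesis by (simp add: q_def)
qed

lemma continuous_on_test_fun [continuous_intros]:
  assumes "0 < \<delta>" "continuous_on S N" "continuous_on S r" "\<And>x. x \<in> S \<Longrightarrow> 0 < N x"
  shows "continuous_on S (\<lambda>x. test_fun \<delta> (N x) (r x))"
proof -
  have "0 < \<delta>\<^sup>2 * (N x)\<^sup>2 + (r x)\<^sup>2" if "x \<in> S" for x
    using assms(1) assms(4)[OF that] by (simp add: add_pos_nonneg)
  then show ?thesis
    unfolding test_fun_def using assms
    by (intro continuous_intros) (auto simp: less_imp_neq[symmetric])
qed

lemma continuous_on_flux_deriv [continuous_intros]:
  assumes "0 < \<epsilon>" "continuous_on S p" "\<And>j. continuous_on S (\<lambda>x. H x j)"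
  shows "continuous_on S (\<lambda>x. flux_deriv \<epsilon> (p x) (H x) i)"
proof -
  have "reg_norm \<epsilon> (p x) \<noteq> 0" for x
    using reg_norm_pos[OF assms(1), of "p x"] by simp
  then show ?thesis
    unfolding flux_deriv_def using assms by (intro continuous_intros) auto
qed

lemma continuous_on_speed:
  assumes "0 < \<epsilon>" "continuous_on UNIV \<phi>" "continuous_on UNIV \<psi>" "Ck 2 v"
  shows "continuous_on UNIV (speed \<phi> \<psi> \<epsilon> v)"
proof -
  note D = Ck2D[OF assms(4)]
  have "continuous_on UNIV (\<lambda>x. (\<Sum>i\<in>UNIV. flux_deriv \<epsilon> (grad v x) (hess_row v x i) i)
    + obstacle_force \<phi> \<psi> \<epsilon> x (v x))"
    unfolding hess_row_def using assms(1-3) D(1-3) by (intro continuous_intros) (simp_all add: hess_row_def)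
  then show ?thesis
    using speed_eq[OF assms(1,4)] by (metis (no_types, lifting) continuous_on_cong)
qed

text \<open>With H the Hessian, the vector on the left is the spatial gradient of the regularised
  gradient norm. The quotient |G| / \<open>reg_norm \<epsilon> G\<close> is at most 1, so only the
  Hessian bound enters.\<close>

lemma norm_reg_norm_deriv_le:
  fixes G :: "real ^ 'n" and H :: "'n \<Rightarrow> 'n \<Rightarrow> real" and B :: real
  assumes "0 < \<epsilon>" "\<And>i j. \<bar>H i j\<bar> \<le> B"
  shows "norm (\<chi> i. (\<Sum>j\<in>UNIV. G $ j * H i j) / reg_norm \<epsilon> G) \<le> CARD('n) * (CARD('n) * B)"
proof -
  have N: "0 < reg_norm \<epsilon> G" using reg_norm_pos assms(1) .
  have comp: "\<bar>(\<Sum>j\<in>UNIV. G $ j * H i j) / reg_norm \<epsilon> G\<bar> \<le> CARD('n) * B" for i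
  proof -
    have "\<bar>\<Sum>j\<in>UNIV. G $ j * H i j\<bar> \<le> (\<Sum>j\<in>UNIV. \<bar>G $ j * H i j\<bar>)" by (rule sum_abs)
    also have "\<dots> \<le> (\<Sum>j\<in>(UNIV::'n set). reg_norm \<epsilon> G * B)"
      unfolding abs_mult using component_le_norm_cart[of G] norm_le_reg_norm[of G \<epsilon>] N assms(2)
      by (intro sum_mono mult_mono) (auto intro: order_trans)
    also have "\<dots> = (CARD('n) * B) * reg_norm \<epsilon> G" by simp
    finally show ?thesis using N by (simp add: abs_divide pos_divide_le_eq)
  qed
  have "norm (\<chi> i. (\<Sum>j\<in>UNIV. G $ j * H i j) / reg_norm \<epsilon> G)
      \<le> (\<Sum>i\<in>UNIV. \<bar>(\<chi> i. (\<Sum>j\<in>UNIV. G $ j * H i j) / reg_norm \<epsilon> G) $ i\<bar>)"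
    by (rule norm_le_l1_cart)
  also have "\<dots> \<le> (\<Sum>i\<in>(UNIV::'n set). CARD('n) * B)"
    using comp by (intro sum_mono) simp
  finally show ?thesis by simp
qed

text \<open>The slices v and v' are those at times t and t + h, and \<rho> is 1 / h. Integration by
  parts moves the divergence onto the test function. Its derivative yields a strongly monotone
  pairing of fluxes and gradients and an error containing the gradient of the regularised norm of v;
  \<open>absorption_inequality\<close> treats both, and the obstacle part has a sign.\<close>

lemma slice_inequality:
  fixes v v' :: "real ^ 'n \<Rightarrow> real" and \<epsilon> \<delta> \<rho> R S B :: real
  assumes pos: "0 < \<epsilon>" "0 < \<delta>" "\<delta> \<le> 1" "0 < \<rho>"
    and cont: "continuous_on UNIV \<phi>" "continuous_on UNIV \<psi>"
    and v: "Ck_torus 2 v" "Ck_torus 2 v'"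
    and R: "\<And>x. x \<in> cbox 0 1 \<Longrightarrow> reg_norm \<epsilon> (grad v x) \<le> R"
      "\<And>x. x \<in> cbox 0 1 \<Longrightarrow> reg_norm \<epsilon> (grad v' x) \<le> R"
    and S: "\<And>x. x \<in> cbox 0 1 \<Longrightarrow> \<bar>\<rho> * (v' x - v x)\<bar> \<le> S"
    and B: "\<And>x i j. x \<in> cbox 0 1 \<Longrightarrow> \<bar>hess_row v x i j\<bar> \<le> B"
  shows "\<rho> * integral (cbox 0 1) (\<lambda>x. (speed \<phi> \<psi> \<epsilon> v' x - speed \<phi> \<psi> \<epsilon> v x)
        * test_fun \<delta> (reg_norm \<epsilon> (grad v x)) (\<rho> * (v' x - v x)))
    \<le> \<delta> * (2 * (CARD('n) * (CARD('n) * B))\<^sup>2 / (mono_const \<epsilon> R * \<epsilon> ^ 3))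
      - \<delta>\<^sup>2 * \<epsilon>\<^sup>2 * mono_const \<epsilon> R / (2 * sqrt (R\<^sup>2 + S\<^sup>2) ^ 3)
        * integral (cbox 0 1) (\<lambda>x. (\<rho> * norm (grad v' x - grad v x))\<^sup>2)"
proof -
  define G G' H H' where "G = grad v" and "G' = grad v'" and "H = hess_row v" and "H' = hess_row v'"
  define N where "N x = reg_norm \<epsilon> (G x)" for x
  define r where "r x = \<rho> * (v' x - v x)" for x
  define \<zeta> where "\<zeta> x = test_fun \<delta> (N x) (r x)" for x
  define gN where "gN x = (\<chi> i. (\<Sum>j\<in>UNIV. G x $ j * H x i j) / N x)" for x
  define q where "q x = sqrt (\<delta>\<^sup>2 * (N x)\<^sup>2 + (r x)\<^sup>2)" for x
  define d\<zeta> where "d\<zeta> i x = \<delta>\<^sup>2 * N x / q x ^ 3 * (N x * (\<rho> * (G' x $ i - G x $ i)) - r x * gN x $ i)" for i x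
  define a where "a x = flux \<epsilon> (G' x) - flux \<epsilon> (G x)" for x
  define da where "da i x = flux_deriv \<epsilon> (G' x) (H' x i) i - flux_deriv \<epsilon> (G x) (H x i) i" for i x
  define w where "w x = speed \<phi> \<psi> \<epsilon> v' x - speed \<phi> \<psi> \<epsilon> v x" for x
  define c where "c = mono_const \<epsilon> R"
  define L where "L = CARD('n) * (CARD('n) * B)"
  define Q where "Q = sqrt (R\<^sup>2 + S\<^sup>2)"
  have C: "Ck 2 v" "Ck 2 v'" and per: "Zd_periodic v" "Zd_periodic v'"
    using v by (auto simp: Ck_torus_def)
  note D = Ck2D[OF C(1)] and D' = Ck2D[OF C(2)]
  have Npos: "0 < N x" for x using reg_norm_pos[OF pos(1)] by (simp add: N_def)
  have qpos: "0 < q x" for x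
    unfolding q_def using Npos[of x] pos by (intro real_sqrt_gt_zero add_pos_nonneg) auto
  have cont': "continuous_on UNIV v" "continuous_on UNIV v'" "continuous_on UNIV G" "continuous_on UNIV G'"
    "\<And>i j. continuous_on UNIV (\<lambda>x. H x i j)" "\<And>i j. continuous_on UNIV (\<lambda>x. H' x i j)"
    using D(1-3) D'(1-3) by (simp_all add: G_def G'_def H_def H'_def hess_row_def)
  have contN: "continuous_on UNIV N" unfolding N_def by (intro continuous_intros cont')
  have contr: "continuous_on UNIV r" unfolding r_def by (intro continuous_intros cont')
  have cont\<zeta>: "continuous_on UNIV \<zeta>"
    unfolding \<zeta>_def using pos Npos by (intro continuous_intros contN contr) auto
  have contgN: "continuous_on UNIV gN"
    unfolding gN_def using Npos by (intro continuous_intros cont' contN) (metis less_irrefl)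
  have contq: "continuous_on UNIV q"
    unfolding q_def by (intro continuous_intros contN contr)
  have contd\<zeta>: "continuous_on UNIV (d\<zeta> i)" for i
    unfolding d\<zeta>_def[abs_def] using less_imp_neq[OF qpos]
    by (intro continuous_intros cont' contN contr contgN contq) auto
  have conta: "continuous_on UNIV a"
    unfolding a_def by (intro continuous_intros pos cont')
  have contda: "continuous_on UNIV (da i)" for i
    unfolding da_def[abs_def] by (intro continuous_intros pos cont')
  have dr: "has_pderiv r (\<rho> * (G' x $ i - G x $ i)) i x" for i x
    unfolding r_def G_def G'_def by (intro DERIV_cmult DERIV_diff D(4) D'(4))
  have dN: "has_pderiv N (gN x $ i) i x" for i x
    unfolding N_def gN_def vec_lambda_beta
    by (rule has_pderiv_reg_norm[OF pos(1)]) (simp add: G_def H_def hess_row_def D(5))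
  have d\<zeta>: "has_pderiv \<zeta> (d\<zeta> i x) i x" for i x
    using DERIV_test_fun[OF pos(2) _ dN[of x i] dr[of x i]] Npos
    by (simp add: \<zeta>_def d\<zeta>_def q_def)
  have dflux: "has_pderiv (\<lambda>y. a y $ i) (da i x) i x" for i x
    unfolding a_def da_def vector_minus_component
    by (intro DERIV_diff has_pderiv_flux[OF pos(1)])
      (simp_all add: G_def H_def G'_def H'_def hess_row_def D(5) D'(5))
  \<comment> \<open>\<open>F i\<close> is the derivative of \<open>a $ i * \<zeta>\<close> in
    direction i; summed over i it is the divergence of \<open>\<zeta> a\<close>, with integral
    zero.\<close>
  define F where "F i x = da i x * \<zeta> x + d\<zeta> i x * a x $ i" for i x
  have contF: "continuous_on UNIV (F i)" for i
    unfolding F_def[abs_def] by (intro continuous_intros contda cont\<zeta> contd\<zeta> conta)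
  have F0: "integral (cbox 0 1) (F i) = 0" for i
  proof (rule integral_cube_pderiv_eq_0)
    show "has_pderiv (\<lambda>y. a y $ i * \<zeta> y) (F i x) i x" for x
      using DERIV_mult[OF dflux[of x i] d\<zeta>[of x i]] by (simp add: F_def)
    have "Zd_periodic G" "Zd_periodic G'"
      using Zd_periodic_grad per by (auto simp: G_def G'_def)
    then show "Zd_periodic (\<lambda>y. a y $ i * \<zeta> y)"
      using per by (simp add: Zd_periodic_def a_def \<zeta>_def N_def r_def)
    show "continuous_on UNIV (\<lambda>y. a y $ i * \<zeta> y)"
      by (intro continuous_intros conta cont\<zeta>)
  qed (rule contF)
  have main: "\<rho> * (w x * \<zeta> x) \<le> \<rho> * (\<Sum>i\<in>UNIV. F i x)
      + \<delta> * (2 * L\<^sup>2 / (c * \<epsilon> ^ 3)) - \<delta>\<^sup>2 * \<epsilon>\<^sup>2 * c / (2 * Q ^ 3) * (\<rho> * norm (G' x - G x))\<^sup>2"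
    if x: "x \<in> cbox 0 1" for x
  proof -
    have R0: "N x \<le> R" "reg_norm \<epsilon> (G' x) \<le> R" and "0 < R"
      using R[OF x] Npos[of x] by (auto simp: N_def G_def G'_def)
    have c0: "0 < c"
      unfolding c_def mono_const_def using pos(1) \<open>0 < R\<close> by (simp add: add_pos_nonneg)
    have epsN: "\<epsilon> \<le> N x"
      using reg_norm_ge[OF pos(1)] by (simp add: N_def)
    have "\<delta> * N x \<le> q x"
      unfolding q_def by (rule real_le_rsqrt) (simp add: power_mult_distrib)
    moreover have "(r x)\<^sup>2 \<le> (q x)\<^sup>2"
      by (simp add: q_def)
    \<comment> \<open>Here \<delta> \<le> 1 makes the upper bound \<open>Q\<close> independent of
      \<delta>.\<close>
    moreover have "q x \<le> Q"
    proof -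
      have "\<delta>\<^sup>2 * (N x)\<^sup>2 \<le> 1 * R\<^sup>2"
        using pos R0 Npos[of x] by (intro mult_mono power_mono) (auto simp: power_le_one)
      moreover have "(r x)\<^sup>2 \<le> S\<^sup>2" using S[OF x] by (simp add: r_def abs_le_square_iff[symmetric])
      ultimately show ?thesis unfolding q_def Q_def by simp
    qed
    moreover have "c * (\<rho> * norm (G' x - G x))\<^sup>2 \<le> \<rho>\<^sup>2 * (a x \<bullet> (G' x - G x))"
    proof -
      have "c * (norm (G' x - G x))\<^sup>2 \<le> a x \<bullet> (G' x - G x)"
        using flux_strongly_monotone[OF pos(1) R0(2) R0(1)[unfolded N_def]]
        by (simp only: c_def mono_const_def a_def)
      then have "\<rho>\<^sup>2 * (c * (norm (G' x - G x))\<^sup>2) \<le> \<rho>\<^sup>2 * (a x \<bullet> (G' x - G x))"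
        by (intro mult_left_mono) auto
      then show ?thesis by (simp add: power_mult_distrib mult.left_commute)
    qed
    moreover have "\<bar>\<rho> * (a x \<bullet> gN x)\<bar> \<le> 2 / \<epsilon> * (\<rho> * norm (G' x - G x)) * L"
    proof -
      have "norm (gN x) \<le> L"
        unfolding gN_def N_def L_def
        by (rule norm_reg_norm_deriv_le) (use pos B[OF x] in \<open>auto simp: H_def\<close>)
      moreover have "norm (a x) \<le> 2 / \<epsilon> * norm (G' x - G x)"
        unfolding a_def by (rule flux_lipschitz[OF pos(1)])
      ultimately have "\<bar>a x \<bullet> gN x\<bar> \<le> 2 / \<epsilon> * norm (G' x - G x) * L"
        using Cauchy_Schwarz_ineq2[of "a x" "gN x"] mult_mono[of "norm (a x)" _ "norm (gN x)" L] pos(1)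
        by (meson norm_ge_zero order_trans)
      then have "\<rho> * \<bar>a x \<bullet> gN x\<bar> \<le> \<rho> * (2 / \<epsilon> * norm (G' x - G x) * L)"
        using pos(4) by (intro mult_left_mono) auto
      then show ?thesis using pos(4) by (simp add: abs_mult mult_ac)
    qed
    ultimately have abs: "\<delta>\<^sup>2 * \<epsilon>\<^sup>2 * c / (2 * Q ^ 3) * (\<rho> * norm (G' x - G x))\<^sup>2 - \<delta> * (2 * L\<^sup>2 / (c * \<epsilon> ^ 3))
      \<le> \<delta>\<^sup>2 * N x / q x ^ 3 * (N x * (\<rho>\<^sup>2 * (a x \<bullet> (G' x - G x))) - r x * (\<rho> * (a x \<bullet> gN x)))"
      by (rule absorption_inequality[OF pos(1,2) c0 epsN])
    have "\<rho> * (\<Sum>i\<in>UNIV. d\<zeta> i x * a x $ i)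
      = \<rho> * (\<delta>\<^sup>2 * N x / q x ^ 3 * (N x * (\<rho> * (a x \<bullet> (G' x - G x))) - r x * (a x \<bullet> gN x)))"
      unfolding d\<zeta>_def inner_vec_def
      by (simp add: sum_distrib_left sum_subtractf[symmetric] algebra_simps)
    also have "\<dots> = \<delta>\<^sup>2 * N x / q x ^ 3 * (N x * (\<rho>\<^sup>2 * (a x \<bullet> (G' x - G x))) - r x * (\<rho> * (a x \<bullet> gN x)))"
      by (simp add: algebra_simps power2_eq_square)
    finally have sum: "\<rho> * (\<Sum>i\<in>UNIV. d\<zeta> i x * a x $ i) = \<dots>" .
    have w: "w x = (\<Sum>i\<in>UNIV. da i x) + (obstacle_force \<phi> \<psi> \<epsilon> x (v' x) - obstacle_force \<phi> \<psi> \<epsilon> x (v x))"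
      by (simp add: w_def speed_eq[OF pos(1)] C da_def G_def G'_def H_def H'_def sum_subtractf)
    \<comment> \<open>The test function has the sign of \<open>v' x - v x\<close>, and the obstacle
      force decreases in the height.\<close>
    have sign: "(obstacle_force \<phi> \<psi> \<epsilon> x (v' x) - obstacle_force \<phi> \<psi> \<epsilon> x (v x)) * \<zeta> x \<le> 0"
    proof (cases "v x \<le> v' x")
      case True
      then have "0 \<le> \<zeta> x" using pos by (simp add: \<zeta>_def test_fun_def r_def)
      then show ?thesis using obstacle_force_antimono[OF pos(1) True, of \<phi> \<psi> x]
        by (intro mult_nonpos_nonneg) simp_all
    next
      case False
      then have "\<zeta> x \<le> 0" using pos
        unfolding \<zeta>_def test_fun_def r_def
        by (intro divide_nonpos_nonneg mult_nonneg_nonpos) (auto simp: add_nonneg_nonneg)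
      then show ?thesis using obstacle_force_antimono[OF pos(1), of "v' x" "v x" \<phi> \<psi> x] False
        by (intro mult_nonneg_nonpos) simp_all
    qed
    have "w x * \<zeta> x = (\<Sum>i\<in>UNIV. F i x) - (\<Sum>i\<in>UNIV. d\<zeta> i x * a x $ i)
      + (obstacle_force \<phi> \<psi> \<epsilon> x (v' x) - obstacle_force \<phi> \<psi> \<epsilon> x (v x)) * \<zeta> x"
      by (simp add: w F_def sum.distrib sum_distrib_right distrib_right)
    then have "w x * \<zeta> x \<le> (\<Sum>i\<in>UNIV. F i x) - (\<Sum>i\<in>UNIV. d\<zeta> i x * a x $ i)"
      using sign by simp
    then have "\<rho> * (w x * \<zeta> x) \<le> \<rho> * ((\<Sum>i\<in>UNIV. F i x) - (\<Sum>i\<in>UNIV. d\<zeta> i x * a x $ i))"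
      using pos by simp
    then show ?thesis using abs unfolding right_diff_distrib sum by linarith
  qed
  have contw: "continuous_on UNIV w"
    unfolding w_def using continuous_on_speed[OF pos(1) cont] C by (intro continuous_intros) auto
  have int: "f integrable_on cbox 0 1" if "continuous_on UNIV f" for f :: "real ^ 'n \<Rightarrow> real"
    using that by (intro integrable_continuous) (rule continuous_on_subset, auto)
  have contg: "continuous_on UNIV (\<lambda>x. (\<rho> * norm (G' x - G x))\<^sup>2)"
    by (intro continuous_intros cont')
  have contFs: "continuous_on UNIV (\<lambda>x. \<Sum>i\<in>UNIV. F i x)"
    by (intro continuous_intros contF)
  define K \<kappa> where "K = \<delta> * (2 * L\<^sup>2 / (c * \<epsilon> ^ 3))" and "\<kappa> = \<delta>\<^sup>2 * \<epsilon>\<^sup>2 * c / (2 * Q ^ 3)"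
  have i1: "(\<lambda>x. \<rho> * (w x * \<zeta> x)) integrable_on cbox 0 1"
    by (intro int continuous_on_mult continuous_on_const contw cont\<zeta>)
  have i2: "(\<lambda>x. \<rho> * (\<Sum>i\<in>UNIV. F i x)) integrable_on cbox 0 1"
    by (intro int continuous_on_mult continuous_on_const contFs)
  have i3: "(\<lambda>x :: real ^ 'n. K) integrable_on cbox 0 1"
    by (intro int continuous_on_const)
  have i4: "(\<lambda>x. \<kappa> * (\<rho> * norm (G' x - G x))\<^sup>2) integrable_on cbox 0 1"
    by (intro int continuous_on_mult continuous_on_const contg)
  have "\<rho> * integral (cbox 0 1) (\<lambda>x. w x * \<zeta> x) = integral (cbox 0 1) (\<lambda>x. \<rho> * (w x * \<zeta> x))"
    by simp
  also have "\<dots> \<le> integral (cbox 0 1) (\<lambda>x. \<rho> * (\<Sum>i\<in>UNIV. F i x) + K - \<kappa> * (\<rho> * norm (G' x - G x))\<^sup>2)"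
    by (intro integral_le[OF i1 integrable_diff[OF integrable_add[OF i2 i3] i4]]
        main[folded K_def \<kappa>_def])
  also have "\<dots> = integral (cbox 0 1) (\<lambda>x. \<rho> * (\<Sum>i\<in>UNIV. F i x))
      + integral (cbox 0 1) (\<lambda>x :: real ^ 'n. K)
      - integral (cbox 0 1) (\<lambda>x. \<kappa> * (\<rho> * norm (G' x - G x))\<^sup>2)"
    unfolding integral_diff[OF integrable_add[OF i2 i3] i4] integral_add[OF i2 i3] ..
  also have "integral (cbox 0 1) (\<lambda>x. \<rho> * (\<Sum>i\<in>UNIV. F i x)) = 0"
    using F0 by (simp add: integral_sum int contF)
  also have "integral (cbox 0 1) (\<lambda>x :: real ^ 'n. K) = K"
    by (simp add: content_unit_cube)
  finally show ?thesis
    by (simp add: w_def \<zeta>_def N_def r_def G_def G'_def c_def L_def Q_def K_def \<kappa>_def)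
qed

section \<open>Evolution of the smoothed norm\<close>

lemma DERIV_within_compose:
  assumes "(f has_real_derivative D) (at (g x) within B)" "(g has_real_derivative D') (at x within A)"
    and "g ` A \<subseteq> B"
  shows "((\<lambda>x. f (g x)) has_real_derivative D * D') (at x within A)"
  using DERIV_image_chain[OF DERIV_subset[OF assms(1,3)] assms(2)] by (simp add: o_def)

text \<open>The derivative \<open>\<delta>\<^sup>2 / sqrt (\<delta>\<^sup>2 + r\<^sup>2) ^ 3\<close>
  is largest at r = 0, where it equals 1 / \<delta>.\<close>

lemma abs_test_fun_diff_le:
  assumes "0 < \<delta>"
  shows "\<bar>test_fun \<delta> 1 a - test_fun \<delta> 1 b\<bar> \<le> \<bar>a - b\<bar> / \<delta>"
proof -
  have pos: "0 < \<delta>\<^sup>2 + r\<^sup>2" for r using assms by (simp add: add_pos_nonneg)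
  have d: "((\<lambda>r. test_fun \<delta> 1 r) has_real_derivative \<delta>\<^sup>2 / sqrt (\<delta>\<^sup>2 + r\<^sup>2) ^ 3) (at r within UNIV)" for r
    using DERIV_test_fun[OF assms, of "\<lambda>_. 1" r 0 "\<lambda>r. r" 1] by simp
  have "\<bar>\<delta>\<^sup>2 / sqrt (\<delta>\<^sup>2 + r\<^sup>2) ^ 3\<bar> \<le> 1 / \<delta>" for r
  proof -
    have "\<delta> \<le> sqrt (\<delta>\<^sup>2 + r\<^sup>2)" by (rule real_le_rsqrt) simp
    then have "\<delta>\<^sup>2 / sqrt (\<delta>\<^sup>2 + r\<^sup>2) ^ 3 \<le> \<delta>\<^sup>2 / \<delta> ^ 3"
      using assms by (intro divide_left_mono power_mono mult_pos_pos) (auto simp: pos)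
    also have "\<dots> = 1 / \<delta>" using assms by (simp add: power2_eq_square power3_eq_cube)
    finally show ?thesis by simp
  qed
  then have "norm (test_fun \<delta> 1 a - test_fun \<delta> 1 b) \<le> 1 / \<delta> * norm (a - b)"
    by (intro field_differentiable_bound[OF convex_UNIV d]) auto
  then show ?thesis by simp
qed

text \<open>This makes the differentiable test function comparable with the smoothed sign of the
  mean of w, through the distance of r / N from that mean.\<close>

lemma test_fun_scale: "0 < N \<Longrightarrow> test_fun \<delta> N r = test_fun \<delta> 1 (r / N)"
proof -
  assume N: "0 < N"
  have "sqrt (\<delta>\<^sup>2 * N\<^sup>2 + r\<^sup>2) = N * sqrt (\<delta>\<^sup>2 + (r / N)\<^sup>2)"
  proof -
    have "\<delta>\<^sup>2 * N\<^sup>2 + r\<^sup>2 = N\<^sup>2 * (\<delta>\<^sup>2 + (r / N)\<^sup>2)"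
      using N by (simp add: field_simps)
    then show ?thesis using N by (simp add: real_sqrt_mult)
  qed
  then show ?thesis by (simp add: test_fun_def)
qed

text \<open>
  The parameter \<open>K\<close> must not depend on \<open>\<delta>\<close>, since \<open>\<delta> * K\<close> is the error that survives the limit of
  vanishing time steps; \<open>\<kappa>\<close> may degenerate with \<open>\<delta>\<close>.
\<close>

locale regularised_evolution =
  fixes w u :: "real ^ 'n \<Rightarrow> real \<Rightarrow> real" and G :: "real ^ 'n \<Rightarrow> real \<Rightarrow> real ^ 'n"
    and \<epsilon> \<delta> \<kappa> K T :: real
  assumes eps: "0 < \<epsilon>" and delta: "0 < \<delta>" and kappa: "0 < \<kappa>" and T: "0 \<le> T" and K: "0 \<le> K"
    and contw: "continuous_on (cbox 0 1 \<times> {0..T + 1}) (\<lambda>(x, t). w x t)"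
    and contG: "continuous_on (cbox 0 1 \<times> {0..T + 1}) (\<lambda>(x, t). G x t)"
    and u: "\<And>x t h. x \<in> cbox 0 1 \<Longrightarrow> t \<in> {0..T} \<Longrightarrow> h \<in> {0<..1} \<Longrightarrow>
      ((\<lambda>\<theta>. reg_norm \<epsilon> (G x (t + \<theta> * h)) * w x (t + \<theta> * h)) has_integral 1 / h * (u x (t + h) - u x t)) {0..1}"
    and key: "\<And>t h. t \<in> {0..T} \<Longrightarrow> h \<in> {0<..1} \<Longrightarrow>
      1 / h * integral (cbox 0 1) (\<lambda>x. (w x (t + h) - w x t)
          * test_fun \<delta> (reg_norm \<epsilon> (G x t)) (1 / h * (u x (t + h) - u x t)))
        \<le> \<delta> * K - \<kappa> * integral (cbox 0 1) (\<lambda>x. (1 / h * norm (G x (t + h) - G x t))\<^sup>2)"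
begin

lemma cont_w [continuous_intros]:
  assumes "continuous_on S f" "continuous_on S g"
    and "\<And>y. y \<in> S \<Longrightarrow> f y \<in> cbox 0 1" "\<And>y. y \<in> S \<Longrightarrow> g y \<in> {0..T + 1}"
  shows "continuous_on S (\<lambda>y. w (f y) (g y))"
  using continuous_on_compose2[OF contw continuous_on_Pair[OF assms(1,2)]] assms(3,4) by force

lemma cont_G [continuous_intros]:
  assumes "continuous_on S f" "continuous_on S g"
    and "\<And>y. y \<in> S \<Longrightarrow> f y \<in> cbox 0 1" "\<And>y. y \<in> S \<Longrightarrow> g y \<in> {0..T + 1}"
  shows "continuous_on S (\<lambda>y. G (f y) (g y))"
  using continuous_on_compose2[OF contG continuous_on_Pair[OF assms(1,2)]] assms(3,4) by force

lemma time_in_range: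
  assumes "t \<in> {0..T}" "h \<in> {0..1}" "\<theta> \<in> {0..1}"
  shows "t + \<theta> * h \<in> {0..T + 1}" "t + h \<in> {0..T + 1}" "t \<in> {0..T + 1}" "\<theta> * h \<in> {0..1}"
proof -
  have "0 \<le> \<theta> * h" "\<theta> * h \<le> 1" using assms by (auto simp: mult_le_one)
  then show "t + \<theta> * h \<in> {0..T + 1}" "t + h \<in> {0..T + 1}" "t \<in> {0..T + 1}" "\<theta> * h \<in> {0..1}"
    using assms by auto
qed

text \<open>
  The mean of \<open>w x\<close> over \<open>[t, t + h]\<close>. Its time derivative is the difference quotient of \<open>w\<close>,
  so no time derivative of \<open>w\<close> is needed.
\<close>

definition w_avg :: "real \<Rightarrow> real ^ 'n \<Rightarrow> real \<Rightarrow> real" where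
  "w_avg h x t = integral {0..1} (\<lambda>\<theta>. w x (t + \<theta> * h))"

lemma cont_w_avg:
  assumes "h \<in> {0..1}"
  shows "continuous_on (cbox 0 1 \<times> {0..T}) (\<lambda>(x, t). w_avg h x t)"
proof -
  have "continuous_on (cbox 0 1 \<times> {0..T}) (\<lambda>y. integral (cbox 0 1) (\<lambda>\<theta>. w (fst y) (snd y + \<theta> * h)))"
    by (rule integral_continuous_on_param)
      (use assms time_in_range in \<open>auto simp: split_beta simp del: atLeastAtMost_iff intro!: continuous_intros\<close>)
  then show ?thesis by (simp add: w_avg_def split_beta)
qed

lemma DERIV_w_avg:
  assumes x: "x \<in> cbox 0 1" and t: "t \<in> {0..T}" and h: "h \<in> {0<..1}"
  shows "(w_avg h x has_real_derivative (w x (t + h) - w x t) / h) (at t within {0..T})"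
proof -
  have h': "h \<in> {0..1}" using h by auto
  \<comment> \<open>A primitive of \<open>w x\<close>: the substitution s + \<theta> h writes the
    mean as a difference quotient of \<open>P\<close>, which is differentiable for continuous
    w.\<close>
  define P where "P s = integral {0..s} (w x)" for s
  have cont: "continuous_on {0..T + 1} (w x)"
    using x by (intro continuous_intros) auto
  have dP: "(P has_real_derivative w x s) (at s within {0..T + 1})" if "s \<in> {0..T + 1}" for s
    unfolding P_def using integral_has_real_derivative[OF cont that] .
  have eq: "w_avg h x s = (P (s + h) - P s) / h" if s: "s \<in> {0..T}" for s
  proof -
    have "((\<lambda>\<theta>. w x (s + \<theta> * h) * h) has_integral (P (s + 1 * h) - P (s + 0 * h))) {0..1}"
    proof (rule fundamental_theorem_of_calculus)
      fix \<theta> :: real assume \<theta>: "\<theta> \<in> {0..1}"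
      have "((\<lambda>\<theta>. s + \<theta> * h) has_real_derivative h) (at \<theta> within {0..1})"
        by (auto intro!: derivative_eq_intros)
      then have "((\<lambda>\<theta>. P (s + \<theta> * h)) has_real_derivative w x (s + \<theta> * h) * h) (at \<theta> within {0..1})"
        by (rule DERIV_within_compose[where g = "\<lambda>\<theta>. s + \<theta> * h", OF dP[OF time_in_range(1)[OF s h' \<theta>]]])
          (use time_in_range(1)[OF s h'] in blast)
      then show "((\<lambda>\<theta>. P (s + \<theta> * h)) has_vector_derivative w x (s + \<theta> * h) * h) (at \<theta> within {0..1})"
        by (simp add: has_real_derivative_iff_has_vector_derivative)
    qed simp
    then have "integral {0..1} (\<lambda>\<theta>. w x (s + \<theta> * h) * h) = P (s + 1 * h) - P (s + 0 * h)"
      by (rule integral_unique)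
    then show ?thesis using h by (simp add: w_avg_def field_simps)
  qed
  have "((\<lambda>s. P (s + h)) has_real_derivative w x (t + h) * 1) (at t within {0..T})"
    using h t by (intro DERIV_within_compose[OF dP]) (auto intro!: derivative_eq_intros)
  moreover have "(P has_real_derivative w x t) (at t within {0..T})"
    by (rule DERIV_subset[OF dP]) (use t in auto)
  ultimately have "((\<lambda>s. (P (s + h) - P s) / h) has_real_derivative (w x (t + h) * 1 - w x t) / h) (at t within {0..T})"
    by (intro DERIV_cdivide DERIV_diff)
  then show ?thesis
    by (intro has_field_derivative_transform_within[of _ _ _ _ 1 "w_avg h x"]) (use t eq in auto)
qed

text \<open>A smoothed L^1 norm of the time means, differentiable in t; it approximates the L^1 norm
  of w as h and \<delta> tend to zero.\<close>

definition J :: "real \<Rightarrow> real \<Rightarrow> real" where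
  "J h t = integral (cbox 0 1) (\<lambda>x. sqrt (\<delta>\<^sup>2 + (w_avg h x t)\<^sup>2))"

text \<open>The time derivative of \<open>J h\<close>: \<open>test_fun \<delta> 1\<close> is the
  derivative of \<open>\<lambda>s. sqrt (\<delta>\<^sup>2 + s\<^sup>2)\<close>.\<close>

definition J' :: "real \<Rightarrow> real \<Rightarrow> real" where
  "J' h t = integral (cbox 0 1) (\<lambda>x. test_fun \<delta> 1 (w_avg h x t) * ((w x (t + h) - w x t) / h))"

lemma cont_w_avg' [continuous_intros]:
  assumes "continuous_on S f" "continuous_on S g" "h \<in> {0..1}"
    and "\<And>y. y \<in> S \<Longrightarrow> f y \<in> cbox 0 1" "\<And>y. y \<in> S \<Longrightarrow> g y \<in> {0..T}"
  shows "continuous_on S (\<lambda>y. w_avg h (f y) (g y))"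
  using continuous_on_compose2[OF cont_w_avg[OF assms(3)] continuous_on_Pair[OF assms(1,2)]] assms(4,5)
  by force

lemma J_has_integral:
  assumes h: "h \<in> {0<..1}"
  shows "(J' h has_integral (J h T - J h 0)) {0..T}"
proof (rule fundamental_theorem_of_calculus[OF T])
  fix t assume t: "t \<in> {0..T}"
  have h': "h \<in> {0..1}" using h by auto
  have pos: "0 < \<delta>\<^sup>2 + r\<^sup>2" for r using delta by (simp add: add_pos_nonneg)
  have "(J h has_real_derivative J' h t) (at t within {0..T})"
    unfolding J_def J'_def
  proof (rule leibniz_rule_field_derivative)
    fix s x assume s: "s \<in> {0..T}" and x: "x \<in> cbox 0 (1 :: real ^ 'n)"
    have "((\<lambda>s. \<delta>\<^sup>2 + (w_avg h x s)\<^sup>2) has_real_derivative 2 * w_avg h x s * ((w x (s + h) - w x s) / h))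
        (at s within {0..T})"
      by (rule DERIV_cong[OF DERIV_add[OF DERIV_const DERIV_power[OF DERIV_w_avg[OF x s h], of 2]]]) simp
    from DERIV_chain2[OF DERIV_real_sqrt[OF pos] this]
    show "((\<lambda>s. sqrt (\<delta>\<^sup>2 + (w_avg h x s)\<^sup>2)) has_real_derivative
        test_fun \<delta> 1 (w_avg h x s) * ((w x (s + h) - w x s) / h)) (at s within {0..T})"
      by (rule DERIV_cong) (simp add: test_fun_def inverse_eq_divide)
  next
    show "(\<lambda>x. sqrt (\<delta>\<^sup>2 + (w_avg h x s)\<^sup>2)) integrable_on cbox 0 1" if "s \<in> {0..T}" for s
      using that h' by (intro integrable_continuous continuous_intros) auto
    show "continuous_on ({0..T} \<times> cbox 0 1)
        (\<lambda>(s, x). test_fun \<delta> 1 (w_avg h x s) * ((w x (s + h) - w x s) / h))"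
      unfolding split_beta using h h' delta by (intro continuous_intros) auto
  qed (use t in auto)
  then show "(J h has_vector_derivative J' h t) (at t within {0..T})"
    by (simp add: has_real_derivative_iff_has_vector_derivative)
qed

section \<open>Replacing the smoothed sign of the mean by the test function\<close>

definition increment :: "real \<Rightarrow> real \<Rightarrow> real ^ 'n \<Rightarrow> real" where
  "increment s t x = norm (G x (t + s) - G x t)"

lemma cont_increment [continuous_intros]:
  assumes "continuous_on S f" "continuous_on S g" "continuous_on S k"
    and "\<And>y. y \<in> S \<Longrightarrow> f y \<in> {0..1}" "\<And>y. y \<in> S \<Longrightarrow> g y \<in> {0..T}" "\<And>y. y \<in> S \<Longrightarrow> k y \<in> cbox 0 1"
  shows "continuous_on S (\<lambda>y. increment (f y) (g y) (k y))"
proof -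
  have "g y + f y \<in> {0..T + 1}" "g y \<in> {0..T + 1}" if "y \<in> S" for y
    using assms(4,5)[OF that] by auto
  then show ?thesis unfolding increment_def using assms by (intro continuous_intros) auto
qed

text \<open>The difference quotient of u divided by N(t) is the mean of w weighted by N(t + \<theta>
  h) / N(t). It differs from the plain mean by the variation of N, which the gradient increments
  control; the smoothed sign contributes the Lipschitz constant 1 / \<delta>.\<close>

lemma test_fun_error:
  assumes x: "x \<in> cbox 0 1" and t: "t \<in> {0..T}" and h: "h \<in> {0<..1}"
    and B: "\<And>s. s \<in> {0..T + 1} \<Longrightarrow> \<bar>w x s\<bar> \<le> B"
  shows "\<bar>test_fun \<delta> 1 (w_avg h x t) - test_fun \<delta> (reg_norm \<epsilon> (G x t)) (1 / h * (u x (t + h) - u x t))\<bar>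
    \<le> B / (\<epsilon> * \<delta>) * integral {0..1} (\<lambda>\<theta>. increment (\<theta> * h) t x)"
proof -
  have h': "h \<in> {0..1}" using h by auto
  note range = time_in_range[OF t h']
  define N where "N s = reg_norm \<epsilon> (G x s)" for s
  have N: "0 < N t" "\<epsilon> \<le> N t" using reg_norm_pos reg_norm_ge eps by (auto simp: N_def)
  define r where "r = 1 / h * (u x (t + h) - u x t)"
  have cont: "continuous_on {0..1} (\<lambda>\<theta>. w x (t + \<theta> * h))"
    using range(1) x by (intro continuous_intros) auto
  have contN: "continuous_on {0..1} (\<lambda>\<theta>. N (t + \<theta> * h))"
    unfolding N_def using range(1) x by (intro continuous_intros) auto
  have contI: "continuous_on {0..1} (\<lambda>\<theta>. increment (\<theta> * h) t x)"
    using range x t by (intro continuous_intros) auto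
  have "((\<lambda>\<theta>. w x (t + \<theta> * h)) has_integral w_avg h x t) {0..1}"
    unfolding w_avg_def by (intro integrable_integral integrable_continuous_interval cont)
  moreover have "((\<lambda>\<theta>. N (t + \<theta> * h) * w x (t + \<theta> * h) / N t) has_integral r / N t) {0..1}"
    using has_integral_divide[OF u[OF x t h], of "N t"] by (simp add: N_def r_def)
  ultimately have "((\<lambda>\<theta>. w x (t + \<theta> * h) - N (t + \<theta> * h) * w x (t + \<theta> * h) / N t)
      has_integral w_avg h x t - r / N t) {0..1}"
    by (rule has_integral_diff)
  then have "w_avg h x t - r / N t
      = integral {0..1} (\<lambda>\<theta>. w x (t + \<theta> * h) - N (t + \<theta> * h) * w x (t + \<theta> * h) / N t)"
    by (simp add: integral_unique)
  also have "norm \<dots> \<le> integral {0..1} (\<lambda>\<theta>. B / \<epsilon> * increment (\<theta> * h) t x)"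
  proof (rule integral_norm_bound_integral)
    show "(\<lambda>\<theta>. w x (t + \<theta> * h) - N (t + \<theta> * h) * w x (t + \<theta> * h) / N t) integrable_on {0..1}"
      using N by (intro integrable_continuous_interval continuous_intros cont contN) auto
    show "(\<lambda>\<theta>. B / \<epsilon> * increment (\<theta> * h) t x) integrable_on {0..1}"
      by (intro integrable_continuous_interval continuous_intros contI)
    fix \<theta> :: real assume \<theta>: "\<theta> \<in> {0..1}"
    have "w x (t + \<theta> * h) - N (t + \<theta> * h) * w x (t + \<theta> * h) / N t
        = w x (t + \<theta> * h) / N t * (N t - N (t + \<theta> * h))"
      using N by (simp add: field_simps)
    then have "norm (w x (t + \<theta> * h) - N (t + \<theta> * h) * w x (t + \<theta> * h) / N t)
        = \<bar>w x (t + \<theta> * h)\<bar> / N t * \<bar>N t - N (t + \<theta> * h)\<bar>"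
      using N by (simp add: abs_mult)
    also have "\<dots> \<le> B / \<epsilon> * increment (\<theta> * h) t x"
      using N eps B[OF range(1)[OF \<theta>]] reg_norm_lipschitz[OF eps, of "G x t" "G x (t + \<theta> * h)"]
      by (intro mult_mono frac_le) (auto simp: increment_def N_def norm_minus_commute)
    finally show "norm (w x (t + \<theta> * h) - N (t + \<theta> * h) * w x (t + \<theta> * h) / N t)
        \<le> B / \<epsilon> * increment (\<theta> * h) t x" .
  qed
  finally have "\<bar>w_avg h x t - r / N t\<bar> \<le> B / \<epsilon> * integral {0..1} (\<lambda>\<theta>. increment (\<theta> * h) t x)"
    by simp
  then have "\<bar>w_avg h x t - r / N t\<bar> / \<delta> \<le> B / \<epsilon> * integral {0..1} (\<lambda>\<theta>. increment (\<theta> * h) t x) / \<delta>"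
    using delta by (intro divide_right_mono) auto
  then show ?thesis
    using abs_test_fun_diff_le[OF delta, of "w_avg h x t" "r / N t"] test_fun_scale[OF N(1), of \<delta> r]
    by (simp add: N_def r_def)
qed

text \<open>Continuity in space comes from the representation of the quotient as an integral of
  continuous functions.\<close>

lemma cont_difference_quotient:
  assumes t: "t \<in> {0..T}" and h: "h \<in> {0<..1}"
  shows "continuous_on (cbox 0 1) (\<lambda>x. 1 / h * (u x (t + h) - u x t))"
proof -
  have h': "h \<in> {0..1}" using h by auto
  have "continuous_on (cbox 0 1) (\<lambda>x. integral (cbox 0 1)
      (\<lambda>\<theta>. reg_norm \<epsilon> (G x (t + \<theta> * h)) * w x (t + \<theta> * h)))"
    by (rule integral_continuous_on_param)
      (use time_in_range(1)[OF t h'] in \<open>auto simp: split_beta simp del: atLeastAtMost_iff intro!: continuous_intros\<close>)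
  then show ?thesis
    by (rule continuous_on_eq) (use u[OF _ t h] in \<open>simp add: integral_unique\<close>)
qed

text \<open>All lags \<theta> h are scaled by the full step h, as they all come from one mean over
  [t, t + h].\<close>

definition sq_avg :: "real \<Rightarrow> real \<Rightarrow> real ^ 'n \<Rightarrow> real" where
  "sq_avg h t x = integral {0..1} (\<lambda>\<theta>. (1 / h * increment (\<theta> * h) t x)\<^sup>2)"

lemma cont_sq_avg:
  assumes "h \<in> {0..1}"
  shows "continuous_on ({0..T} \<times> cbox 0 1) (\<lambda>(t, x). sq_avg h t x)"
proof -
  have "continuous_on ({0..T} \<times> cbox 0 1)
      (\<lambda>y. integral (cbox 0 1) (\<lambda>\<theta>. (1 / h * increment (\<theta> * h) (fst y) (snd y))\<^sup>2))"
  proof (rule integral_continuous_on_param)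
    show "continuous_on (({0..T} \<times> cbox 0 1) \<times> cbox 0 1)
        (\<lambda>(y, \<theta>). (1 / h * increment (\<theta> * h) (fst y) (snd y))\<^sup>2)"
      unfolding split_beta using assms by (intro continuous_intros) (auto simp: mult_le_one)
  qed
  then show ?thesis by (simp add: sq_avg_def split_beta)
qed

lemma integral_scaled_increment:
  "integral (cbox 0 1) (\<lambda>x. (c * increment s t x)\<^sup>2) = c\<^sup>2 * integral (cbox 0 1) (\<lambda>x. (increment s t x)\<^sup>2)"
  by (simp only: power_mult_distrib integral_mult_right)

text \<open>In \<open>J'\<close> the smoothed sign of the mean is exchanged for the test function of
  \<open>key\<close>. The exchange costs the error of \<open>test_fun_error\<close> times the
  oscillation \<omega> of w, divided by h, and the scaled increment is bounded through its
  square.\<close>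

lemma J'_le:
  assumes t: "t \<in> {0..T}" and h: "h \<in> {0<..1}"
    and B: "\<And>x s. x \<in> cbox 0 1 \<Longrightarrow> s \<in> {0..T + 1} \<Longrightarrow> \<bar>w x s\<bar> \<le> B"
    and \<omega>: "\<And>x. x \<in> cbox 0 1 \<Longrightarrow> \<bar>w x (t + h) - w x t\<bar> \<le> \<omega>"
  shows "J' h t \<le> \<delta> * K - \<kappa> * integral (cbox 0 1) (\<lambda>x. (1 / h * increment h t x)\<^sup>2)
    + B / (\<epsilon> * \<delta>) * \<omega> * (1 + integral (cbox 0 1) (sq_avg h t))"
proof -
  have h': "h \<in> {0..1}" using h by auto
  note range = time_in_range[OF t h']
  define \<zeta> where "\<zeta> x = test_fun \<delta> (reg_norm \<epsilon> (G x t)) (1 / h * (u x (t + h) - u x t))" for x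
  define M where "M = B / (\<epsilon> * \<delta>)"
  have B0: "0 \<le> B"
    using B[of 0 0] T abs_ge_zero[of "w 0 0"] by (auto simp: mem_box_cart)
  have M0: "0 \<le> M" using B0 eps delta by (simp add: M_def)
  have \<omega>0: "0 \<le> \<omega>" using \<omega>[of 0] by (auto simp: mem_box_cart)
  have "t \<in> {0..T + 1}" "t + h \<in> {0..T + 1}" using t h by auto
  then have contdw: "continuous_on (cbox 0 1) (\<lambda>x. w x (t + h) - w x t)"
    by (intro continuous_intros) auto
  have cont\<zeta>: "continuous_on (cbox 0 1) \<zeta>"
    unfolding \<zeta>_def using \<open>t \<in> {0..T + 1}\<close> delta reg_norm_pos[OF eps]
    by (intro continuous_on_test_fun continuous_on_reg_norm cont_G cont_difference_quotient[OF t h]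
        continuous_on_const continuous_on_id) auto
  have contA: "continuous_on (cbox 0 1) (sq_avg h t)"
  proof -
    have c: "continuous_on (cbox 0 1) (\<lambda>x :: real ^ 'n. (t, x))" by (intro continuous_intros)
    have sub: "(\<lambda>x. (t, x)) ` cbox 0 1 \<subseteq> {0..T} \<times> cbox 0 (1 :: real ^ 'n)"
      using t by (intro image_subsetI SigmaI)
    show ?thesis
      using continuous_on_compose2[OF cont_sq_avg[OF h'] c sub] by simp
  qed
  have contw: "continuous_on (cbox 0 1) (\<lambda>x. w_avg h x t)"
    using t h' by (intro continuous_intros) auto
  have pt: "test_fun \<delta> 1 (w_avg h x t) * ((w x (t + h) - w x t) / h)
      \<le> 1 / h * ((w x (t + h) - w x t) * \<zeta> x) + M * \<omega> * (1 + sq_avg h t x)"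
    if x: "x \<in> cbox 0 1" for x
  proof -
    define I where "I = integral {0..1} (\<lambda>\<theta>. increment (\<theta> * h) t x)"
    define d where "d = w x (t + h) - w x t"
    have contI: "continuous_on {0..1} (\<lambda>\<theta>. increment (\<theta> * h) t x)"
      using range x t by (intro continuous_intros) auto
    have I1: "1 / h * I = integral {0..1} (\<lambda>\<theta>. 1 / h * increment (\<theta> * h) t x)"
      by (simp add: I_def)
    also have "\<dots> \<le> integral {0..1} (\<lambda>\<theta>. 1 + (1 / h * increment (\<theta> * h) t x)\<^sup>2)"
    proof (rule integral_le)
      fix \<theta> :: real
      show "1 / h * increment (\<theta> * h) t x \<le> 1 + (1 / h * increment (\<theta> * h) t x)\<^sup>2"
      proof -
        \<comment> \<open>The error is linear in the scaled increment; the passage to squares makes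
          it comparable with the dissipation.\<close>
        have "y \<le> 1 + y\<^sup>2" for y :: real
          using zero_le_power2[of "y - 1"] zero_le_power2[of "y + 1"] by (simp add: power2_sum power2_diff)
        then show ?thesis .
      qed
    qed (intro integrable_continuous_interval continuous_intros contI)+
    also have "\<dots> = 1 + sq_avg h t x"
      unfolding sq_avg_def
      using h by (subst integral_add) (auto intro!: integrable_continuous_interval continuous_intros contI)
    finally have I: "1 / h * I \<le> 1 + sq_avg h t x" .
    have "I \<ge> 0" unfolding I_def
      by (intro integral_nonneg integrable_continuous_interval contI) (auto simp: increment_def)
    have "(test_fun \<delta> 1 (w_avg h x t) - \<zeta> x) * d \<le> \<bar>test_fun \<delta> 1 (w_avg h x t) - \<zeta> x\<bar> * \<bar>d\<bar>"
      by (metis abs_ge_self abs_mult)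
    also have "\<dots> \<le> (M * I) * \<omega>"
      using test_fun_error[OF x t h B[OF x]] \<omega>[OF x] M0 \<open>I \<ge> 0\<close>
      by (intro mult_mono) (auto simp: M_def I_def \<zeta>_def d_def)
    finally have "1 / h * ((test_fun \<delta> 1 (w_avg h x t) - \<zeta> x) * d) \<le> 1 / h * ((M * I) * \<omega>)"
      using h by (intro mult_left_mono) auto
    also have "\<dots> = M * \<omega> * (1 / h * I)" by simp
    also have "\<dots> \<le> M * \<omega> * (1 + sq_avg h t x)"
      using I M0 \<omega>0 by (intro mult_left_mono) auto
    finally have "1 / h * ((test_fun \<delta> 1 (w_avg h x t) - \<zeta> x) * d) \<le> M * \<omega> * (1 + sq_avg h t x)" .
    moreover have "test_fun \<delta> 1 (w_avg h x t) * (d / h)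
        = 1 / h * (d * \<zeta> x) + 1 / h * ((test_fun \<delta> 1 (w_avg h x t) - \<zeta> x) * d)"
      by (simp add: algebra_simps diff_divide_distrib)
    ultimately show ?thesis unfolding d_def[symmetric] by linarith
  qed
  have i1: "(\<lambda>x. 1 / h * ((w x (t + h) - w x t) * \<zeta> x)) integrable_on cbox 0 1"
    by (intro integrable_continuous continuous_on_mult continuous_on_const contdw cont\<zeta>)
  have i2: "(\<lambda>x. M * \<omega> * (1 + sq_avg h t x)) integrable_on cbox 0 1"
    by (intro integrable_continuous continuous_on_mult continuous_on_add continuous_on_const contA)
  have i3: "(\<lambda>x. test_fun \<delta> 1 (w_avg h x t) * ((w x (t + h) - w x t) / h)) integrable_on cbox 0 1"
    using h delta
    by (intro integrable_continuous continuous_on_mult continuous_on_divide continuous_on_test_fun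
        continuous_on_const contdw contw) auto
  have "J' h t \<le> integral (cbox 0 1) (\<lambda>x. 1 / h * ((w x (t + h) - w x t) * \<zeta> x) + M * \<omega> * (1 + sq_avg h t x))"
    unfolding J'_def by (rule integral_le[OF i3 integrable_add[OF i1 i2] pt])
  also have "\<dots> = 1 / h * integral (cbox 0 1) (\<lambda>x. (w x (t + h) - w x t) * \<zeta> x)
      + M * \<omega> * integral (cbox 0 1) (\<lambda>x. 1 + sq_avg h t x)"
    unfolding integral_add[OF i1 i2] by simp
  also have "integral (cbox 0 1) (\<lambda>x. 1 + sq_avg h t x) = 1 + integral (cbox 0 1) (sq_avg h t)"
    by (subst integral_add) (auto intro!: integrable_continuous contA simp: content_unit_cube)
  finally show ?thesis
    using key[OF t h] by (simp add: M_def \<zeta>_def increment_def)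
qed

section \<open>Space-time energy of the gradient increments\<close>

definition energy :: "real \<Rightarrow> real" where
  "energy s = integral {0..T} (\<lambda>t. integral (cbox 0 1) (\<lambda>x. (increment s t x)\<^sup>2))"

lemma cont_increment_integral:
  "continuous_on ({0..T} \<times> {0..1}) (\<lambda>(t, s). integral (cbox 0 1) (\<lambda>x. (increment s t x)\<^sup>2))"
proof -
  have "continuous_on ({0..T} \<times> {0..1}) (\<lambda>y. integral (cbox 0 1) (\<lambda>x. (increment (snd y) (fst y) x)\<^sup>2))"
  proof (rule integral_continuous_on_param)
    show "continuous_on (({0..T} \<times> {0..1}) \<times> cbox 0 1) (\<lambda>(y, x). (increment (snd y) (fst y) x)\<^sup>2)"
      unfolding split_beta by (intro continuous_intros) auto
  qed
  then show ?thesis by (simp add: split_beta)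
qed

lemma cont_energy: "continuous_on {0..1} energy"
proof -
  have "continuous_on {0..1} (\<lambda>s. integral (cbox 0 T) (\<lambda>t. integral (cbox 0 1) (\<lambda>x. (increment s t x)\<^sup>2)))"
  proof (rule integral_continuous_on_param)
    show "continuous_on ({0..1} \<times> cbox 0 T) (\<lambda>(s, t). integral (cbox 0 1) (\<lambda>x. (increment s t x)\<^sup>2))"
      using continuous_on_compose2[OF cont_increment_integral, of "{0..1} \<times> {0..T}" "\<lambda>y. (snd y, fst y)"]
      by (force simp: split_beta intro!: continuous_intros)
  qed
  then show ?thesis by (simp add: energy_def[abs_def])
qed

text \<open>Two exchanges of integrals, first of x with \<theta> and then of t with \<theta>, turn
  the error term into a mean of energies at the lags \<theta> h.\<close>

lemma integral_sq_avg:
  assumes h: "h \<in> {0<..1}"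
  shows "integral {0..T} (\<lambda>t. integral (cbox 0 1) (sq_avg h t)) = integral {0..1} (\<lambda>\<theta>. (1 / h)\<^sup>2 * energy (\<theta> * h))"
proof -
  define Z where "Z t s = integral (cbox 0 1) (\<lambda>x. (increment s t x)\<^sup>2)" for t s
  have h': "h \<in> {0..1}" using h by auto
  have "integral (cbox 0 1) (sq_avg h t) = integral {0..1} (\<lambda>\<theta>. (1 / h)\<^sup>2 * Z t (\<theta> * h))"
    if t: "t \<in> {0..T}" for t
  proof -
    have "integral (cbox 0 1) (\<lambda>x. integral (cbox 0 1) (\<lambda>\<theta>. (1 / h * increment (\<theta> * h) t x)\<^sup>2))
        = integral (cbox 0 1) (\<lambda>\<theta>. integral (cbox 0 1) (\<lambda>x. (1 / h * increment (\<theta> * h) t x)\<^sup>2))"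
    proof (rule integral_swap_continuous)
      show "continuous_on (cbox (0, 0) (1, 1)) (\<lambda>(x, \<theta>). (1 / h * increment (\<theta> * h) t x)\<^sup>2)"
        unfolding split_beta cbox_Pair_eq using t h'
        by (intro continuous_intros) (auto simp: mult_le_one)
    qed
    then show ?thesis
      unfolding integral_scaled_increment by (simp add: sq_avg_def[abs_def] Z_def)
  qed
  then have "integral {0..T} (\<lambda>t. integral (cbox 0 1) (sq_avg h t))
      = integral {0..T} (\<lambda>t. integral {0..1} (\<lambda>\<theta>. (1 / h)\<^sup>2 * Z t (\<theta> * h)))"
    by (intro integral_cong) auto
  also have "\<dots> = integral {0..1} (\<lambda>\<theta>. integral {0..T} (\<lambda>t. (1 / h)\<^sup>2 * Z t (\<theta> * h)))"
  proof -
    have "continuous_on (cbox (0, 0) (T, 1)) (\<lambda>(t, \<theta>). (1 / h)\<^sup>2 * Z t (\<theta> * h))"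
    proof -
      have "continuous_on ({0..T} \<times> {0..1}) (\<lambda>y. Z (fst y) (snd y * h))"
        unfolding Z_def
        using continuous_on_compose2[OF cont_increment_integral,
            of "{0..T} \<times> {0..1}" "\<lambda>y. (fst y, snd y * h)"] h'
        by (force simp: mult_le_one intro!: continuous_intros)
      then show ?thesis
        unfolding split_beta cbox_Pair_eq box_real by (intro continuous_intros)
    qed
    from integral_swap_continuous[OF this] show ?thesis by simp
  qed
  finally show ?thesis by (simp add: energy_def Z_def)
qed

text \<open>\<open>J'_le\<close> integrated over [0, T]. The dissipation involves the energy at lag
  h, the error the energies at all lags in [0, h]; hence the common bound E.\<close>

lemma energy_step:
  assumes h: "h \<in> {0<..1}"
    and B: "\<And>x s. x \<in> cbox 0 1 \<Longrightarrow> s \<in> {0..T + 1} \<Longrightarrow> \<bar>w x s\<bar> \<le> B"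
    and \<omega>: "\<And>x t. x \<in> cbox 0 1 \<Longrightarrow> t \<in> {0..T} \<Longrightarrow> \<bar>w x (t + h) - w x t\<bar> \<le> \<omega>"
    and E: "\<And>s. s \<in> {0..h} \<Longrightarrow> energy s \<le> E"
  shows "J h T - J h 0 \<le> \<delta> * K * T - \<kappa> * (energy h / h\<^sup>2) + B / (\<epsilon> * \<delta>) * \<omega> * (T + E / h\<^sup>2)"
proof -
  have h': "h \<in> {0..1}" using h by auto
  define M where "M = B / (\<epsilon> * \<delta>) * \<omega>"
  have B0: "0 \<le> B"
    using B[of 0 0] T abs_ge_zero[of "w 0 0"] by (auto simp: mem_box_cart)
  have \<omega>0: "0 \<le> \<omega>" using \<omega>[of 0 0] T by (auto simp: mem_box_cart)
  have M0: "0 \<le> M" using B0 \<omega>0 eps delta by (simp add: M_def)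
  define Y1 where "Y1 t = integral (cbox 0 1) (\<lambda>x. (increment h t x)\<^sup>2)" for t
  define Y2 where "Y2 t = integral (cbox 0 1) (sq_avg h t)" for t
  have c1: "continuous_on {0..T} Y1"
    unfolding Y1_def
    using continuous_on_compose2[OF cont_increment_integral, of "{0..T}" "\<lambda>t. (t, h)"] h'
    by (force intro!: continuous_intros)
  have c2: "continuous_on {0..T} Y2"
    unfolding Y2_def by (rule integral_continuous_on_param) (rule cont_sq_avg[OF h'])
  have i2: "(\<lambda>\<theta>. (1 / h)\<^sup>2 * energy (\<theta> * h)) integrable_on {0..1}"
    using h' by (intro integrable_continuous_interval continuous_on_mult continuous_on_const
        continuous_on_compose2[OF cont_energy] continuous_on_id) (auto simp: mult_le_one)
  have "J h T - J h 0 = integral {0..T} (J' h)"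
    using J_has_integral[OF h] by (simp add: integral_unique)
  also have "\<dots> \<le> integral {0..T} (\<lambda>t. (\<delta> * K + M) - \<kappa> * (1 / h)\<^sup>2 * Y1 t + M * Y2 t)"
  proof (rule integral_le)
    show "J' h integrable_on {0..T}" using J_has_integral[OF h] by (rule has_integral_integrable)
    show "(\<lambda>t. (\<delta> * K + M) - \<kappa> * (1 / h)\<^sup>2 * Y1 t + M * Y2 t) integrable_on {0..T}"
      by (intro integrable_continuous_interval continuous_intros c1 c2)
    fix t assume t: "t \<in> {0..T}"
    show "J' h t \<le> (\<delta> * K + M) - \<kappa> * (1 / h)\<^sup>2 * Y1 t + M * Y2 t"
      using J'_le[OF t h B \<omega>[OF _ t]]
      unfolding integral_scaled_increment by (simp add: M_def Y1_def Y2_def algebra_simps)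
  qed
  also have "\<dots> = (\<delta> * K + M) * T - \<kappa> * (1 / h)\<^sup>2 * integral {0..T} Y1 + M * integral {0..T} Y2"
    using T by (subst integral_add, (intro integrable_continuous_interval continuous_intros c1 c2)+,
      subst integral_diff, (intro integrable_continuous_interval continuous_intros c1 c2)+) simp
  also have "integral {0..T} Y1 = energy h" by (simp add: Y1_def[abs_def] energy_def)
  also have "integral {0..T} Y2 = integral {0..1} (\<lambda>\<theta>. (1 / h)\<^sup>2 * energy (\<theta> * h))"
    unfolding Y2_def by (rule integral_sq_avg[OF h])
  also have "M * integral {0..1} (\<lambda>\<theta>. (1 / h)\<^sup>2 * energy (\<theta> * h)) \<le> M * integral {0..1} (\<lambda>\<theta>::real. (1 / h)\<^sup>2 * E)"
  proof (intro mult_left_mono[OF _ M0] integral_le[OF i2])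
    fix \<theta> :: real assume "\<theta> \<in> {0..1}"
    then have "\<theta> * h \<in> {0..h}" using h by (auto simp: mult_left_le_one_le)
    then show "(1 / h)\<^sup>2 * energy (\<theta> * h) \<le> (1 / h)\<^sup>2 * E" by (intro mult_left_mono E) auto
  qed auto
  finally show ?thesis
    by (simp add: M_def power_divide algebra_simps)
qed

text \<open>\<open>energy_step\<close> is used twice. With one fixed small oscillation of w it gives
  an energy of order h^2. Then \<open>E / h\<^sup>2\<close> is bounded, and with an arbitrarily
  small oscillation \<omega> the whole error is a constant times \<omega>.\<close>

lemma integral_abs_le:
  "integral (cbox 0 1) (\<lambda>x. \<bar>w x T\<bar>) \<le> integral (cbox 0 1) (\<lambda>x. \<bar>w x 0\<bar>) + \<delta> + \<delta> * K * T"
proof -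
  let ?C = "cbox 0 1 :: (real ^ 'n) set"
  have compact: "compact (?C \<times> {0..T + 1})" by (intro compact_Times compact_cbox compact_Icc)
  obtain B where B: "0 < B" "\<And>x s. x \<in> ?C \<Longrightarrow> s \<in> {0..T + 1} \<Longrightarrow> \<bar>w x s\<bar> \<le> B"
  proof -
    have "bounded ((\<lambda>(x, t). w x t) ` (?C \<times> {0..T + 1}))"
      using compact_continuous_image[OF contw compact] compact_imp_bounded by blast
    then obtain B where "0 < B" "\<forall>y\<in>(\<lambda>(x, t). w x t) ` (?C \<times> {0..T + 1}). norm y \<le> B"
      unfolding bounded_pos by blast
    then show thesis by (intro that[of B]) force+
  qed
  \<comment> \<open>Uniform continuity of w on the compact space-time cylinder; one step length
    serves all points and times.\<close>
  have osc: "\<exists>h\<in>{0<..1}. \<forall>s\<in>{0..h}. \<forall>x\<in>?C. \<forall>t\<in>{0..T}. \<bar>w x (t + s) - w x t\<bar> \<le> \<omega>"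
    if "0 < \<omega>" for \<omega>
  proof -
    obtain d where d: "0 < d" "\<And>p q. p \<in> ?C \<times> {0..T + 1} \<Longrightarrow> q \<in> ?C \<times> {0..T + 1} \<Longrightarrow> dist q p < d
        \<Longrightarrow> dist (case q of (x, t) \<Rightarrow> w x t) (case p of (x, t) \<Rightarrow> w x t) < \<omega>"
    proof -
      have "\<exists>d>0. \<forall>p\<in>?C \<times> {0..T + 1}. \<forall>q\<in>?C \<times> {0..T + 1}. dist q p < d
          \<longrightarrow> dist (case q of (x, t) \<Rightarrow> w x t) (case p of (x, t) \<Rightarrow> w x t) < \<omega>"
        using compact_uniformly_continuous[OF contw compact] \<open>0 < \<omega>\<close>
        unfolding uniformly_continuous_on_def by blast
      then show thesis using that by blast
    qed
    have "\<bar>w x (t + s) - w x t\<bar> \<le> \<omega>" if "s \<in> {0..min 1 (d / 2)}" "x \<in> ?C" "t \<in> {0..T}" for s x t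
      using d(2)[of "(x, t)" "(x, t + s)"] that d(1) by (auto simp: dist_Pair_Pair dist_real_def)
    then show ?thesis using d(1) by (intro bexI[of _ "min 1 (d / 2)"]) auto
  qed
  have energy0: "0 \<le> energy s" for s
  proof -
    \<comment> \<open>No condition on \<open>s\<close> is required: a function that is not
      integrable has integral 0 by convention.\<close>
    have "0 \<le> integral ?C (\<lambda>x. (increment s t x)\<^sup>2)" for t
      by (cases "(\<lambda>x. (increment s t x)\<^sup>2) integrable_on ?C")
        (auto intro: integral_nonneg simp: not_integrable_integral)
    then show ?thesis
      unfolding energy_def
      by (cases "(\<lambda>t. integral ?C (\<lambda>x. (increment s t x)\<^sup>2)) integrable_on {0..T}")
        (auto intro: integral_nonneg simp: not_integrable_integral)
  qed
  define M where "M = B / (\<epsilon> * \<delta>)"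
  have M: "0 < M" using B(1) eps delta by (simp add: M_def)
  \<comment> \<open>The choice makes \<open>M * \<omega>1\<close> equal to
    \<open>\<kappa> / 2\<close>, so that the error is half of a dissipation term. \<open>A\<close>
    collects the remaining terms divided by \<kappa>, with \<delta> + B bounding the initial value
    of \<open>J\<close>.\<close>
  define \<omega>1 where "\<omega>1 = \<kappa> / (2 * M)"
  define A where "A = (\<delta> + B + \<delta> * K * T + M * \<omega>1 * T) / \<kappa>"
  have \<omega>1: "0 < \<omega>1" using M kappa by (simp add: \<omega>1_def)
  have A: "0 \<le> A" unfolding A_def using delta B(1) K T M \<omega>1 kappa by simp
  have w_avg_close: "\<bar>w_avg h x t - w x t\<bar> \<le> \<omega>"
    if "\<And>s. s \<in> {0..h} \<Longrightarrow> \<bar>w x (t + s) - w x t\<bar> \<le> \<omega>" "h \<in> {0<..1}" "x \<in> ?C" "t \<in> {0..T}" for \<omega> h x t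
  proof -
    have h': "h \<in> {0..1}" using that(2) by auto
    have i: "(\<lambda>\<theta>. w x (t + \<theta> * h)) integrable_on {0..1}"
      using time_in_range(1)[OF that(4) h'] that(3)
      by (intro integrable_continuous_interval continuous_intros) auto
    have "w_avg h x t - w x t = integral {0..1} (\<lambda>\<theta>. w x (t + \<theta> * h) - w x t)"
      unfolding w_avg_def by (subst integral_diff[OF i]) auto
    also have "norm \<dots> \<le> integral {0..1} (\<lambda>\<theta>::real. \<omega>)"
      using that(1,2)
      by (intro integral_norm_bound_integral integrable_diff i integrable_const_ivl)
        (auto simp: mult_left_le_one_le)
    finally show ?thesis by simp
  qed
  have c_abs: "continuous_on ?C (\<lambda>x. \<bar>w x t\<bar>)" if "t \<in> {0..T}" for t
    using that by (intro continuous_intros) auto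
  have c_J: "continuous_on ?C (\<lambda>x. sqrt (\<delta>\<^sup>2 + (w_avg h x t)\<^sup>2))" if "h \<in> {0<..1}" "t \<in> {0..T}" for h t
    using that by (intro continuous_intros) auto
  have J0: "0 \<le> J h t" if "h \<in> {0<..1}" "t \<in> {0..T}" for h t
    unfolding J_def using c_J[OF that] by (intro integral_nonneg integrable_continuous) auto
  have J_le: "J h t \<le> integral ?C (\<lambda>x. \<bar>w x t\<bar> + (\<omega> + \<delta>))"
    if "\<And>s x. s \<in> {0..h} \<Longrightarrow> x \<in> ?C \<Longrightarrow> \<bar>w x (t + s) - w x t\<bar> \<le> \<omega>" "h \<in> {0<..1}" "t \<in> {0..T}" for h t \<omega>
    unfolding J_def
  proof (rule integral_le)
    show "(\<lambda>x. \<bar>w x t\<bar> + (\<omega> + \<delta>)) integrable_on ?C"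
      by (intro integrable_continuous continuous_on_add c_abs continuous_on_const that)
    show "(\<lambda>x. sqrt (\<delta>\<^sup>2 + (w_avg h x t)\<^sup>2)) integrable_on ?C"
      by (intro integrable_continuous c_J that)
    fix x assume x: "x \<in> ?C"
    have "sqrt (\<delta>\<^sup>2 + (w_avg h x t)\<^sup>2) \<le> \<delta> + \<bar>w_avg h x t\<bar>"
      using sqrt_sum_squares_le_sum_abs[of \<delta> "w_avg h x t"] delta by simp
    then show "sqrt (\<delta>\<^sup>2 + (w_avg h x t)\<^sup>2) \<le> \<bar>w x t\<bar> + (\<omega> + \<delta>)"
      using w_avg_close[OF that(1)[OF _ x] that(2) x that(3)] by linarith
  qed
  have J_ge: "integral ?C (\<lambda>x. \<bar>w x t\<bar>) \<le> J h t + \<omega>"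
    if "\<And>s x. s \<in> {0..h} \<Longrightarrow> x \<in> ?C \<Longrightarrow> \<bar>w x (t + s) - w x t\<bar> \<le> \<omega>" "h \<in> {0<..1}" "t \<in> {0..T}" for h t \<omega>
  proof -
    have "integral ?C (\<lambda>x. \<bar>w x t\<bar>) \<le> integral ?C (\<lambda>x. sqrt (\<delta>\<^sup>2 + (w_avg h x t)\<^sup>2) + \<omega>)"
    proof (rule integral_le)
      show "(\<lambda>x. \<bar>w x t\<bar>) integrable_on ?C" by (intro integrable_continuous c_abs that)
      show "(\<lambda>x. sqrt (\<delta>\<^sup>2 + (w_avg h x t)\<^sup>2) + \<omega>) integrable_on ?C"
        by (intro integrable_continuous continuous_on_add c_J continuous_on_const that)
      fix x assume x: "x \<in> ?C"
      have "\<bar>w_avg h x t\<bar> \<le> sqrt (\<delta>\<^sup>2 + (w_avg h x t)\<^sup>2)" by (rule real_le_rsqrt) simp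
      then show "\<bar>w x t\<bar> \<le> sqrt (\<delta>\<^sup>2 + (w_avg h x t)\<^sup>2) + \<omega>"
        using w_avg_close[OF that(1)[OF _ x] that(2) x that(3)] by linarith
    qed
    also have "\<dots> = J h t + \<omega>"
      unfolding J_def using c_J[OF that(2,3)]
      by (subst integral_add) (auto intro: integrable_continuous simp: content_unit_cube)
    finally show ?thesis .
  qed
  have J_bound: "J h 0 \<le> \<delta> + B" if "h \<in> {0<..1}" for h
  proof -
    have "J h 0 \<le> integral ?C (\<lambda>x. \<delta> + B)"
      unfolding J_def
    proof (rule integral_le)
      show "(\<lambda>x. sqrt (\<delta>\<^sup>2 + (w_avg h x 0)\<^sup>2)) integrable_on ?C"
        using T by (intro integrable_continuous c_J that) auto
      fix x assume x: "x \<in> ?C"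
      have h': "h \<in> {0..1}" "(0::real) \<in> {0..T}" using that T by auto
      have "norm (w_avg h x 0) \<le> integral {0..1} (\<lambda>\<theta>::real. B)"
        unfolding w_avg_def
        using time_in_range(1)[OF h'(2,1)] x
        by (intro integral_norm_bound_integral integrable_continuous_interval continuous_intros)
          (auto simp del: atLeastAtMost_iff intro!: B(2))
      then show "sqrt (\<delta>\<^sup>2 + (w_avg h x 0)\<^sup>2) \<le> \<delta> + B"
        using sqrt_sum_squares_le_sum_abs[of \<delta> "w_avg h x 0"] delta by simp
    qed (rule integrable_const)
    then show ?thesis by (simp add: content_unit_cube)
  qed
  obtain h1 where h1: "h1 \<in> {0<..1}" "\<And>s x t. s \<in> {0..h1} \<Longrightarrow> x \<in> ?C \<Longrightarrow> t \<in> {0..T} \<Longrightarrow> \<bar>w x (t + s) - w x t\<bar> \<le> \<omega>1"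
    using osc[OF \<omega>1] by blast
  \<comment> \<open>Since the oscillation of \<open>w\<close> is small, the error terms of shorter steps are absorbed by the
    dissipation, which gives the bound \<open>O(h\<^sup>2)\<close> for the energy.\<close>
  have absorb: "energy h \<le> A * h\<^sup>2 + E / 2"
    if h: "h \<in> {0<..h1}" and E: "\<And>s. s \<in> {0..h} \<Longrightarrow> energy s \<le> E" for h E
  proof -
    have h01: "h \<in> {0<..1}" using h h1(1) by auto
    have "J h T - J h 0 \<le> \<delta> * K * T - \<kappa> * (energy h / h\<^sup>2) + M * \<omega>1 * (T + E / h\<^sup>2)"
      unfolding M_def using h h1(2) by (intro energy_step[OF h01 B(2) _ E]) auto
    moreover have "\<kappa> * A = \<delta> + B + \<delta> * K * T + M * \<omega>1 * T" using kappa by (simp add: A_def)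
    moreover have "0 \<le> J h T" using J0[OF h01] T by simp
    ultimately have "\<kappa> * (energy h / h\<^sup>2) \<le> \<kappa> * A + M * \<omega>1 * (E / h\<^sup>2)"
      using J_bound[OF h01] unfolding distrib_left by linarith
    also have "M * \<omega>1 = \<kappa> / 2" using M by (simp add: \<omega>1_def)
    finally have "\<kappa> * (energy h / h\<^sup>2) \<le> \<kappa> * (A + E / h\<^sup>2 / 2)" by (simp add: algebra_simps)
    then have "energy h / h\<^sup>2 \<le> A + E / h\<^sup>2 / 2" using kappa by (rule mult_left_le_imp_le)
    then have "energy h / h\<^sup>2 * h\<^sup>2 \<le> (A + E / h\<^sup>2 / 2) * h\<^sup>2" by (intro mult_right_mono) auto
    then show ?thesis using h by (simp add: algebra_simps)
  qed
  have energy_le: "energy s \<le> 2 * A * h\<^sup>2" if h: "h \<in> {0<..h1}" and s: "s \<in> {0..h}" for h s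
  proof -
    have "continuous_on {0..h} energy"
      using h h1(1) by (intro continuous_on_subset[OF cont_energy]) auto
    then have "bounded (energy ` {0..h})"
      by (intro compact_imp_bounded compact_continuous_image compact_Icc)
    then have bdd: "bdd_above (energy ` {0..h})" by (rule bounded_imp_bdd_above)
    \<comment> \<open>The supremum is finite by continuity of the energy. Applying
      \<open>absorb\<close> at every lag in (0, h] gives
      \<open>S \<le> A * h\<^sup>2 + S / 2\<close>, so half of \<open>S\<close> can be
      subtracted.\<close>
    define S where "S = Sup (energy ` {0..h})"
    have S: "energy s \<le> S" if "s \<in> {0..h}" for s
      unfolding S_def using bdd that by (intro cSup_upper) auto
    have S0: "0 \<le> S" using S[of 0] energy0[of 0] h by auto
    have "energy s \<le> A * h\<^sup>2 + S / 2" if s: "s \<in> {0..h}" for s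
    proof (cases "s = 0")
      \<comment> \<open>Lag zero is no admissible step for \<open>absorb\<close>, but there the
        increment vanishes.\<close>
      case True
      have "energy 0 = 0" by (simp add: energy_def increment_def)
      then show ?thesis using True A S0 by simp
    next
      case False
      have "energy s \<le> A * s\<^sup>2 + S / 2"
        using False s h by (intro absorb S) auto
      also have "\<dots> \<le> A * h\<^sup>2 + S / 2"
        using s A by (intro add_right_mono mult_left_mono power_mono) auto
      finally show ?thesis .
    qed
    then have "S \<le> A * h\<^sup>2 + S / 2" unfolding S_def using h by (intro cSup_least) auto
    then show ?thesis using S[OF s] by simp
  qed
  \<comment> \<open>Second use of \<open>energy_step\<close>, with
    \<open>E = 2 * A * h\<^sup>2\<close>. Neither \<open>M\<close> nor \<open>A\<close> depends on
    \<omega>; the summand 2 comes from comparing \<open>J\<close> with the L^1 norm at both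
    ends.\<close>
  have main: "integral ?C (\<lambda>x. \<bar>w x T\<bar>) \<le> integral ?C (\<lambda>x. \<bar>w x 0\<bar>) + \<delta> + \<delta> * K * T + (M * (T + 2 * A) + 2) * \<omega>"
    if \<omega>: "0 < \<omega>" for \<omega>
  proof -
    obtain h0 where h0: "h0 \<in> {0<..1}" "\<And>s x t. s \<in> {0..h0} \<Longrightarrow> x \<in> ?C \<Longrightarrow> t \<in> {0..T} \<Longrightarrow> \<bar>w x (t + s) - w x t\<bar> \<le> \<omega>"
      using osc[OF \<omega>] by blast
    \<comment> \<open>\<open>h1\<close> secures the energy bound, \<open>h0\<close> the oscillation
      \<omega>.\<close>
    define h where "h = min h0 h1"
    have h: "h \<in> {0<..1}" "h \<in> {0<..h1}" "h \<in> {0<..h0}" using h0(1) h1(1) by (auto simp: h_def)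
    have osc_h: "\<bar>w x (t + s) - w x t\<bar> \<le> \<omega>" if "s \<in> {0..h}" "x \<in> ?C" "t \<in> {0..T}" for s x t
      using h0(2)[of s x t] that h by auto
    have "J h T - J h 0 \<le> \<delta> * K * T - \<kappa> * (energy h / h\<^sup>2) + M * \<omega> * (T + 2 * A * h\<^sup>2 / h\<^sup>2)"
      unfolding M_def using h by (intro energy_step[OF h(1) B(2) osc_h energy_le[OF h(2)]]) auto
    also have "\<dots> \<le> \<delta> * K * T + M * \<omega> * (T + 2 * A)"
      using kappa energy0[of h] h by simp
    finally have "J h T \<le> J h 0 + \<delta> * K * T + M * \<omega> * (T + 2 * A)" by simp
    moreover have "integral ?C (\<lambda>x. \<bar>w x T\<bar>) \<le> J h T + \<omega>"
      using T by (intro J_ge h osc_h) auto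
    moreover have "J h 0 \<le> integral ?C (\<lambda>x. \<bar>w x 0\<bar> + (\<omega> + \<delta>))"
      using T by (intro J_le h osc_h) auto
    moreover have "integral ?C (\<lambda>x. \<bar>w x 0\<bar> + (\<omega> + \<delta>)) = integral ?C (\<lambda>x. \<bar>w x 0\<bar>) + (\<omega> + \<delta>)"
      using c_abs[of 0] T by (subst integral_add) (auto intro: integrable_continuous simp: content_unit_cube)
    ultimately show ?thesis by (simp add: algebra_simps)
  qed
  show ?thesis
  proof (rule field_le_epsilon)
    fix e :: real assume e: "0 < e"
    define c where "c = M * (T + 2 * A) + 2"
    have c: "0 < c" unfolding c_def using M T A by (simp add: add_nonneg_pos)
    show "integral ?C (\<lambda>x. \<bar>w x T\<bar>) \<le> integral ?C (\<lambda>x. \<bar>w x 0\<bar>) + \<delta> + \<delta> * K * T + e"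
      using main[of "e / c"] e c by (simp add: c_def[symmetric])
  qed
qed

end

section \<open>Contraction for classical solutions\<close>

lemma bounded_on_compact_real:
  fixes f :: "'a :: topological_space \<Rightarrow> real"
  assumes "compact S" "continuous_on S f"
  obtains B where "0 < B" "\<And>x. x \<in> S \<Longrightarrow> \<bar>f x\<bar> \<le> B"
  using compact_imp_bounded[OF compact_continuous_image[OF assms(2,1)]]
  unfolding bounded_pos by auto

lemma C21_torusD:
  assumes "C21_torus u"
  shows "continuous_on (UNIV \<times> {0..}) (\<lambda>(x, t). grad (\<lambda>y. u y t) x)"
    "continuous_on (UNIV \<times> {0..}) (\<lambda>(x, t). hess_row (\<lambda>y. u y t) x i j)"
    "continuous_on (UNIV \<times> {0..}) (\<lambda>(x, t). u x t)"
    "0 \<le> t \<Longrightarrow> Ck_torus 2 (\<lambda>y. u y t)"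
    "0 < t \<Longrightarrow> (u x has_real_derivative deriv (u x) t) (at t)"
proof -
  have "continuous_on (UNIV \<times> {0..}) (\<lambda>y. \<chi> i. partial_deriv i (\<lambda>z. u z (snd y)) (fst y))"
    using assms unfolding C21_torus_def split_beta by (intro continuous_on_vec_lambda) blast
  then show "continuous_on (UNIV \<times> {0..}) (\<lambda>(x, t). grad (\<lambda>y. u y t) x)"
    by (simp add: grad_def split_beta)
  show "continuous_on (UNIV \<times> {0..}) (\<lambda>(x, t). hess_row (\<lambda>y. u y t) x i j)"
    using assms unfolding C21_torus_def hess_row_def by blast
  show "continuous_on (UNIV \<times> {0..}) (\<lambda>(x, t). u x t)" "0 \<le> t \<Longrightarrow> Ck_torus 2 (\<lambda>y. u y t)"
    using assms unfolding C21_torus_def by blast+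
  show "0 < t \<Longrightarrow> (u x has_real_derivative deriv (u x) t) (at t)"
    using assms unfolding C21_torus_def by (simp add: DERIV_deriv_iff_real_differentiable)
qed

lemma continuous_on_speed_space_time:
  assumes "0 < \<epsilon>" "continuous_on UNIV \<phi>" "continuous_on UNIV \<psi>" "C21_torus u"
  shows "continuous_on (UNIV \<times> {0..}) (\<lambda>(x, t). speed \<phi> \<psi> \<epsilon> (\<lambda>y. u y t) x)"
proof -
  note D = C21_torusD[OF assms(4), unfolded split_beta]
  have "continuous_on (UNIV \<times> {0..}) (\<lambda>y. (\<Sum>i\<in>UNIV. flux_deriv \<epsilon> (grad (\<lambda>z. u z (snd y)) (fst y))
        (hess_row (\<lambda>z. u z (snd y)) (fst y) i) i)
      + obstacle_force \<phi> \<psi> \<epsilon> (fst y) (u (fst y) (snd y)))"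
    by (intro continuous_on_add continuous_on_sum continuous_on_flux_deriv continuous_on_obstacle_force
        assms(1-3) D(1-3) continuous_on_fst continuous_on_id)
  moreover have "speed \<phi> \<psi> \<epsilon> (\<lambda>z. u z (snd y)) (fst y) = (\<Sum>i\<in>UNIV. flux_deriv \<epsilon> (grad (\<lambda>z. u z (snd y)) (fst y))
        (hess_row (\<lambda>z. u z (snd y)) (fst y) i) i)
      + obstacle_force \<phi> \<psi> \<epsilon> (fst y) (u (fst y) (snd y))" if "y \<in> UNIV \<times> {0..}" for y
    using that C21_torusD(4)[OF assms(4), of "snd y"]
    by (subst speed_eq[OF assms(1)]) (auto simp: Ck_torus_def)
  ultimately show ?thesis
    unfolding split_beta by (simp cong: continuous_on_cong)
qed

text \<open>Compactness of the cube times [0, T + 1] gives bounds for N, w and the Hessian, uniform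
  in the step h and in \<delta>. The locale then applies for every \<delta> in (0, 1], and \<delta>
  tends to zero.\<close>

lemma speed_L1_nonincreasing:
  fixes u :: "real ^ 'n \<Rightarrow> real \<Rightarrow> real"
  assumes eps: "0 < \<epsilon>" and obst: "continuous_on UNIV \<phi>" "continuous_on UNIV \<psi>"
    and sol: "classical_solution \<phi> \<psi> g \<epsilon> u" and T: "0 \<le> T"
  shows "integral (cbox 0 1) (\<lambda>x. \<bar>speed \<phi> \<psi> \<epsilon> (\<lambda>y. u y T) x\<bar>)
    \<le> integral (cbox 0 1) (\<lambda>x. \<bar>speed \<phi> \<psi> \<epsilon> (\<lambda>y. u y 0) x\<bar>)"
proof -
  let ?C = "cbox 0 1 :: (real ^ 'n) set"
  \<comment> \<open>The extra unit of time leaves room for steps h \<le> 1 that start in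
    [0, T].\<close>
  let ?D = "?C \<times> {0..T + 1}"
  define w where "w x t = speed \<phi> \<psi> \<epsilon> (\<lambda>y. u y t) x" for x t
  define G where "G x t = grad (\<lambda>y. u y t) x" for x t
  define N where "N x t = reg_norm \<epsilon> (G x t)" for x t
  have reg: "C21_torus u" using sol by (simp add: classical_solution_def)
  note D = C21_torusD[OF reg]
  have sub: "?D \<subseteq> UNIV \<times> {0..}" by auto
  have compact: "compact ?D" by (intro compact_Times compact_cbox compact_Icc)
  have contw: "continuous_on (UNIV \<times> {0..}) (\<lambda>(x, t). w x t)"
    unfolding w_def by (rule continuous_on_speed_space_time[OF eps obst reg])
  have contG: "continuous_on (UNIV \<times> {0..}) (\<lambda>(x, t). G x t)"
    unfolding G_def by (rule D(1))
  have contN: "continuous_on (UNIV \<times> {0..}) (\<lambda>(x, t). N x t)"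
    using contG unfolding N_def split_beta by (intro continuous_intros)
  have ut: "(u x has_real_derivative N x t * w x t) (at t)" if "0 < t" for x t
  proof -
    have "Ck 2 (\<lambda>y. u y t)" using D(4)[of t] that by (simp add: Ck_torus_def)
    from reg_norm_mult_speed[OF eps this, of x \<phi> \<psi>] have "deriv (u x) t = N x t * w x t"
      using sol that unfolding classical_solution_def N_def w_def G_def by simp
    then show ?thesis using D(5)[OF that, of x] by simp
  qed
  have quot: "((\<lambda>\<theta>. N x (t + \<theta> * h) * w x (t + \<theta> * h)) has_integral 1 / h * (u x (t + h) - u x t)) {0..1}"
    if "t \<in> {0..T}" "h \<in> {0<..1}" for x t h
  proof -
    have "((\<lambda>\<theta>. N x (t + \<theta> * h) * w x (t + \<theta> * h)) has_integral
        1 / h * u x (t + 1 * h) - 1 / h * u x (t + 0 * h)) {0..1}"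
    \<comment> \<open>The time derivative is at hand for positive times only, so for t = 0 the
      endpoint \<theta> = 0 must be left out.\<close>
    proof (rule fundamental_theorem_of_calculus_interior)
      have "continuous_on {0..1} (\<lambda>\<theta>::real. (x, t + \<theta> * h))" by (intro continuous_intros)
      moreover have "(\<lambda>\<theta>. (x, t + \<theta> * h)) ` {0..1} \<subseteq> UNIV \<times> {0..}" using that by auto
      ultimately have "continuous_on {0..1} (\<lambda>\<theta>::real. case (x, t + \<theta> * h) of (x, t) \<Rightarrow> u x t)"
        by (rule continuous_on_compose2[OF D(3)])
      then have "continuous_on {0..1} (\<lambda>\<theta>::real. u x (t + \<theta> * h))" by simp
      then show "continuous_on {0..1} (\<lambda>\<theta>::real. 1 / h * u x (t + \<theta> * h))"
        by (intro continuous_intros)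
      fix \<theta> :: real assume "\<theta> \<in> {0<..<1}"
      then have "0 < t + \<theta> * h" using that by (auto simp: add_nonneg_pos)
      then have "((\<lambda>\<theta>. u x (t + \<theta> * h)) has_real_derivative N x (t + \<theta> * h) * w x (t + \<theta> * h) * h) (at \<theta>)"
        by (intro DERIV_chain2[where f = "u x" and g = "\<lambda>\<theta>. t + \<theta> * h", OF ut])
          (auto intro!: derivative_eq_intros)
      from DERIV_cmult[OF this, of "1 / h"] that
      have "((\<lambda>\<theta>. 1 / h * u x (t + \<theta> * h)) has_real_derivative N x (t + \<theta> * h) * w x (t + \<theta> * h)) (at \<theta>)"
        by simp
      then show "((\<lambda>\<theta>. 1 / h * u x (t + \<theta> * h)) has_vector_derivative N x (t + \<theta> * h) * w x (t + \<theta> * h)) (at \<theta>)"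
        by (simp add: has_real_derivative_iff_has_vector_derivative)
    qed simp
    then show ?thesis by (simp add: right_diff_distrib diff_divide_distrib)
  qed
  obtain R where R: "0 < R" "\<And>y. y \<in> ?D \<Longrightarrow> \<bar>case y of (x, t) \<Rightarrow> N x t\<bar> \<le> R"
    using bounded_on_compact_real[OF compact continuous_on_subset[OF contN sub]] by blast
  have R': "reg_norm \<epsilon> (grad (\<lambda>y. u y t) x) \<le> R" if "(x, t) \<in> ?D" for x t
    using R(2)[OF that] by (simp add: N_def G_def)
  obtain Bw where Bw: "0 < Bw" "\<And>y. y \<in> ?D \<Longrightarrow> \<bar>case y of (x, t) \<Rightarrow> w x t\<bar> \<le> Bw"
    using bounded_on_compact_real[OF compact continuous_on_subset[OF contw sub]] by blast
  have "\<exists>b. 0 < b \<and> (\<forall>x t. (x, t) \<in> ?D \<longrightarrow> \<bar>hess_row (\<lambda>y. u y t) x i j\<bar> \<le> b)" for i j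
    using bounded_on_compact_real[OF compact continuous_on_subset[OF D(2) sub], of i j] by (metis case_prod_conv)
  then obtain b where b: "\<And>i j. 0 < b i j" "\<And>i j x t. (x, t) \<in> ?D \<Longrightarrow> \<bar>hess_row (\<lambda>y. u y t) x i j\<bar> \<le> b i j"
    by metis
  define B where "B = (\<Sum>i\<in>UNIV. \<Sum>j\<in>UNIV. b i j)"
  have bB: "b i j \<le> B" for i j
  proof -
    have "b i j \<le> (\<Sum>j\<in>UNIV. b i j)" using b(1) by (intro member_le_sum) (auto intro: less_imp_le)
    also have "\<dots> \<le> B"
      unfolding B_def using b(1)
      by (intro member_le_sum[of i UNIV "\<lambda>i. \<Sum>j\<in>UNIV. b i j"] sum_nonneg) (auto intro: less_imp_le)
    finally show ?thesis .
  qed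
  \<comment> \<open>Bounds the difference quotient of u, which is a mean of N w.\<close>
  define S where "S = R * Bw"
  define K where "K = 2 * (CARD('n) * (CARD('n) * B))\<^sup>2 / (mono_const \<epsilon> R * \<epsilon> ^ 3)"
  have c: "0 < mono_const \<epsilon> R"
    unfolding mono_const_def using eps R(1) by (simp add: add_pos_nonneg)
  have K: "0 \<le> K" unfolding K_def using c eps by simp
  have main: "integral ?C (\<lambda>x. \<bar>w x T\<bar>) \<le> integral ?C (\<lambda>x. \<bar>w x 0\<bar>) + \<delta> + \<delta> * K * T"
    if \<delta>: "0 < \<delta>" "\<delta> \<le> 1" for \<delta>
  proof -
    define \<kappa> where "\<kappa> = \<delta>\<^sup>2 * \<epsilon>\<^sup>2 * mono_const \<epsilon> R / (2 * sqrt (R\<^sup>2 + S\<^sup>2) ^ 3)"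
    have "regularised_evolution w u G \<epsilon> \<delta> \<kappa> K T"
    proof
      show "0 < \<kappa>" unfolding \<kappa>_def using \<delta> eps c R(1) by (simp add: add_pos_nonneg)
      show "continuous_on (?C \<times> {0..T + 1}) (\<lambda>(x, t). w x t)"
        "continuous_on (?C \<times> {0..T + 1}) (\<lambda>(x, t). G x t)"
        using contw contG sub by (blast intro: continuous_on_subset)+
      fix t h assume t: "t \<in> {0..T}" and h: "h \<in> {0<..1::real}"
      have tD: "(x, t) \<in> ?D" "(x, t + h) \<in> ?D" "\<theta> \<in> {0..1} \<Longrightarrow> (x, t + \<theta> * h) \<in> ?D" if "x \<in> ?C" for x \<theta>
      proof -
        have "0 \<le> \<theta> * h" "\<theta> * h \<le> 1" if "\<theta> \<in> {0..1}" using that h by (auto simp: mult_le_one)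
        then show "(x, t) \<in> ?D" "(x, t + h) \<in> ?D" "\<theta> \<in> {0..1} \<Longrightarrow> (x, t + \<theta> * h) \<in> ?D"
          using t h \<open>x \<in> ?C\<close> by auto
      qed
      have S: "\<bar>1 / h * (u x (t + h) - u x t)\<bar> \<le> S" if x: "x \<in> ?C" for x
      proof -
        have "norm (1 / h * (u x (t + h) - u x t)) \<le> S * measure lborel (cbox 0 (1::real))"
        proof (rule has_integral_bound)
          show "((\<lambda>\<theta>. N x (t + \<theta> * h) * w x (t + \<theta> * h)) has_integral 1 / h * (u x (t + h) - u x t)) (cbox 0 1)"
            using quot[OF t h] by simp
          fix \<theta> :: real assume "\<theta> \<in> cbox 0 1"
          then show "norm (N x (t + \<theta> * h) * w x (t + \<theta> * h)) \<le> S"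
            unfolding S_def norm_mult
            using R(2)[OF tD(3)[OF x, of \<theta>]] Bw(2)[OF tD(3)[OF x, of \<theta>]] R(1) by (intro mult_mono) auto
        qed (use R(1) Bw(1) in \<open>simp add: S_def\<close>)
        then show ?thesis by simp
      qed
      have "Ck_torus 2 (\<lambda>y. u y t)" "Ck_torus 2 (\<lambda>y. u y (t + h))" using D(4) t h by auto
      from slice_inequality[OF eps \<delta> _ obst this, of "1 / h" R S B]
      show "1 / h * integral ?C (\<lambda>x. (w x (t + h) - w x t)
          * test_fun \<delta> (reg_norm \<epsilon> (G x t)) (1 / h * (u x (t + h) - u x t)))
        \<le> \<delta> * K - \<kappa> * integral ?C (\<lambda>x. (1 / h * norm (G x (t + h) - G x t))\<^sup>2)"
        using R'[OF tD(1)] R'[OF tD(2)] S order_trans[OF b(2)[OF tD(1)] bB] h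
        by (simp add: w_def G_def N_def K_def \<kappa>_def)
    qed (use eps \<delta> T K quot in \<open>auto simp: N_def\<close>)
    then show ?thesis by (rule regularised_evolution.integral_abs_le)
  qed
  have "integral ?C (\<lambda>x. \<bar>w x T\<bar>) \<le> integral ?C (\<lambda>x. \<bar>w x 0\<bar>)"
  proof (rule field_le_epsilon)
    fix e :: real assume e: "0 < e"
    \<comment> \<open>Chosen so that the total error \<delta> (1 + K T) is at most
      \<open>e\<close>.\<close>
    define \<delta> where "\<delta> = min 1 (e / (1 + K * T))"
    have KT: "0 < 1 + K * T" using K T by (simp add: add_pos_nonneg)
    then have \<delta>: "0 < \<delta>" "\<delta> \<le> 1" "\<delta> \<le> e / (1 + K * T)" using e by (auto simp: \<delta>_def)
    have "\<delta> + \<delta> * K * T = \<delta> * (1 + K * T)" by (simp add: algebra_simps)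
    also have "\<dots> \<le> e" using \<delta>(3) KT by (simp add: pos_le_divide_eq)
    finally show "integral ?C (\<lambda>x. \<bar>w x T\<bar>) \<le> integral ?C (\<lambda>x. \<bar>w x 0\<bar>) + e"
      using main[OF \<delta>(1,2)] by linarith
  qed
  then show ?thesis by (simp add: w_def)
qed

theorem theorem3p1:
  fixes \<phi> \<psi> g :: "real ^ 'n \<Rightarrow> real"
    and u :: "real \<Rightarrow> real ^ 'n \<Rightarrow> real \<Rightarrow> real"
  assumes "Ck_torus 1 \<phi>" and "Ck_torus 1 \<psi>" and "Ck_torus 2 g"
    and "\<And>x. \<phi> x < \<psi> x"
    and "\<And>x. \<phi> x \<le> g x" and "\<And>x. g x \<le> \<psi> x"
    and "\<And>\<epsilon>. \<epsilon> \<in> {0<..<1} \<Longrightarrow> classical_solution \<phi> \<psi> g \<epsilon> (u \<epsilon>)"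
    and "bdd_above ((\<lambda>\<epsilon>. integral (cbox 0 1)
           (\<lambda>x. \<bar>- curvature \<epsilon> (\<lambda>y. u \<epsilon> y 0) x + forcing \<phi> \<psi> \<epsilon> (\<lambda>y. u \<epsilon> y 0) x\<bar>)) ` {0<..<1})"
  shows "bdd_above ((\<lambda>(\<epsilon>, t). integral (cbox 0 1)
           (\<lambda>x. \<bar>- curvature \<epsilon> (\<lambda>y. u \<epsilon> y t) x + forcing \<phi> \<psi> \<epsilon> (\<lambda>y. u \<epsilon> y t) x\<bar>)) ` ({0<..<1} \<times> {0..}))"
proof -
  have cont: "continuous_on UNIV \<phi>" "continuous_on UNIV \<psi>"
    using assms(1,2) by (simp_all add: Ck_torus_def)
  obtain M where M: "\<And>\<epsilon>. \<epsilon> \<in> {0<..<1} \<Longrightarrow>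
      integral (cbox 0 1) (\<lambda>x. \<bar>speed \<phi> \<psi> \<epsilon> (\<lambda>y. u \<epsilon> y 0) x\<bar>) \<le> M"
    using assms(8) unfolding bdd_above_def speed_def by blast
  \<comment> \<open>For each \<epsilon> the norm never exceeds its initial value, so the bound
    \<open>M\<close> at time 0, uniform in \<epsilon>, serves at all times.\<close>
  have "integral (cbox 0 1) (\<lambda>x. \<bar>speed \<phi> \<psi> \<epsilon> (\<lambda>y. u \<epsilon> y t) x\<bar>) \<le> M"
    if "\<epsilon> \<in> {0<..<1}" "0 \<le> t" for \<epsilon> t
    using speed_L1_nonincreasing[OF _ cont assms(7)[OF that(1)] that(2)] M[OF that(1)] that(1) by force
  then show ?thesis
    by (intro bdd_aboveI[of _ M]) (auto simp: speed_def)
qed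

end
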